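(* Let $X\ne\{0\}$ be a complex Banach space with open unit ball $B_X$. Let $k,m\in\mathbb{N}$, $p>0$, $\lambda\in(0,\infty)$ and $a\in[0,1)$, and let $R_4$ be the minimal positive root in $(0,1)$ of the equation $\Psi_4(r)=0$, where $$\Psi_4(r)=(1+ar^m)^p\big[1+(\lambda a^2-\lambda-1)r^k\big]-(1-r^k)(a+r^m)^p .$$ Let $f:B_X\to\mathbb{D}$ be holomorphic with homogeneous polynomial expansion $f(z)=\sum_{j=0}^\infty P_j(z)$, $z\in B_X$, and $|f(0)|=a$. For $n\in\mathbb{N}$ let $\mu_n:B_X\to B_X$ be a Schwarz mapping having a zero of order $n$ at $z=0$. Then $$I_f(z):=|f(\mu_m(z))|^p+\lambda\Big[\sum_{j=1}^\infty|P_j(\mu_k(z))|+\Big(\frac1{1+a}+\frac{r^k}{1-r^k}\Big)\sum_{j=1}^\infty|P_j(\mu_k(z))|^2\Big]\le1$$ for $\|z\|=r\le R_4$. The radius $R_4$ is best possible: for every $R\in(R_4,1)$ there exist such $f$ (with $|f(0)|=a$) and $\mu_n$ ($n\ge1$) and a point $z\in B_X$ with $\|z\|=r\le R$ such that $I_f(z)>1$.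
   Context: $\mathbb{N}=\{1,2,\dots\}$ and $\mathbb{D}=\{z\in\mathbb{C}:|z|<1\}$. A homogeneous polynomial of degree $j$ on $X$ is a map $P_j(x)=u(x,\dots,x)$ for a (continuous) $j$-linear map $u$ on $X^j$; $P_0$ is the constant $f(0)$. Every holomorphic $f:B_X\to\mathbb{D}$ has a unique expansion $f(z)=\sum_{j\ge0}P_j(z)$ on $B_X$ with $P_j$ homogeneous of degree $j$. A Schwarz mapping is a holomorphic map $\mu:B_X\to B_X$ with $\mu(0)=0$; it has a zero of order $n$ at $0$ if the first non-zero term of its homogeneous polynomial expansion at $0$ has degree $n$. *)

theory Defs
  imports "HOL-Analysis.Analysis"
begin

class complex_banach = banach +
  fixes scaleC :: "complex \<Rightarrow> 'a \<Rightarrow> 'a" (infixr "*\<^sub>C" 75)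
  assumes scaleC_add_right: "c *\<^sub>C (x + y) = c *\<^sub>C x + c *\<^sub>C y"
    and scaleC_add_left: "(c + d) *\<^sub>C x = c *\<^sub>C x + d *\<^sub>C x"
    and scaleC_scaleC: "c *\<^sub>C d *\<^sub>C x = (c * d) *\<^sub>C x"
    and scaleC_of_real: "complex_of_real t *\<^sub>C x = t *\<^sub>R x"
    and norm_scaleC: "norm (c *\<^sub>C x) = cmod c * norm x"

instantiation complex :: complex_banach
begin

definition scaleC_complex :: "complex \<Rightarrow> complex \<Rightarrow> complex" where
  "scaleC_complex = (*)"

instance
  by standard (auto simp: scaleC_complex_def algebra_simps norm_mult scaleR_conv_of_real)

end

text \<open>The predicate below uses \<^const>\<open>Vector_Spaces.linear\<close>, which contains the assertion that
  both scalar multiplications are vector space structures; this lemma discharges it.\<close>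

lemma vector_space_scaleC: "vector_space (scaleC :: complex \<Rightarrow> 'a \<Rightarrow> 'a::complex_banach)"
proof
  fix c d :: complex and x y :: 'a
  show "c *\<^sub>C (x + y) = c *\<^sub>C x + c *\<^sub>C y" by (rule scaleC_add_right)
  show "(c + d) *\<^sub>C x = c *\<^sub>C x + d *\<^sub>C x" by (rule scaleC_add_left)
  show "c *\<^sub>C d *\<^sub>C x = (c * d) *\<^sub>C x" by (rule scaleC_scaleC)
  show "1 *\<^sub>C x = x" using scaleC_of_real[of 1 x] by simp
qed

abbreviation clinear :: "('a::complex_banach \<Rightarrow> 'b::complex_banach) \<Rightarrow> bool" where
  "clinear \<equiv> Vector_Spaces.linear scaleC scaleC"

text \<open>Holomorphy on an open set: complex Frechet differentiability at each point. Continuity of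
  the derivative \<open>D\<close> is part of \<^const>\<open>has_derivative\<close>.\<close>

definition holomorphic_map_on ::
    "('a::complex_banach \<Rightarrow> 'b::complex_banach) \<Rightarrow> 'a set \<Rightarrow> bool" where
  "holomorphic_map_on f S \<longleftrightarrow> (\<forall>z\<in>S. \<exists>D. clinear D \<and> (f has_derivative D) (at z))"

text \<open>A \<open>j\<close>-linear map on \<open>X\<^sup>j\<close> is encoded as a function on sequences that depends only on the
  entries with index below \<open>j\<close>. For such functions, continuity for the product topology on
  sequences is the same as continuity on \<open>X\<^sup>j\<close>. For \<open>j = 0\<close> these are the constants.\<close>

definition continuous_multilinear ::
    "nat \<Rightarrow> ((nat \<Rightarrow> 'a::complex_banach) \<Rightarrow> 'b::complex_banach) \<Rightarrow> bool" where
  "continuous_multilinear j u \<longleftrightarrow>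
     (\<forall>v w. (\<forall>i<j. v i = w i) \<longrightarrow> u v = u w) \<and>
     (\<forall>i<j. \<forall>w. clinear (\<lambda>x. u (w(i := x)))) \<and>
     continuous_on UNIV u"

definition homogeneous_polynomial ::
    "nat \<Rightarrow> ('a::complex_banach \<Rightarrow> 'b::complex_banach) \<Rightarrow> bool" where
  "homogeneous_polynomial j P \<longleftrightarrow>
     (\<exists>u. continuous_multilinear j u \<and> (\<forall>x. P x = u (\<lambda>_. x)))"

definition homogeneous_expansion ::
    "('a::complex_banach \<Rightarrow> 'b::complex_banach) \<Rightarrow> (nat \<Rightarrow> 'a \<Rightarrow> 'b) \<Rightarrow> bool" where
  "homogeneous_expansion f P \<longleftrightarrow>
     (\<forall>j. homogeneous_polynomial j (P j)) \<and> (\<forall>z\<in>ball 0 1. (\<lambda>j. P j z) sums f z)"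

definition schwarz_map :: "('a::complex_banach \<Rightarrow> 'a) \<Rightarrow> bool" where
  "schwarz_map \<mu> \<longleftrightarrow>
     holomorphic_map_on \<mu> (ball 0 1) \<and> \<mu> ` ball 0 1 \<subseteq> ball 0 1 \<and> \<mu> 0 = 0"

definition zero_of_order :: "nat \<Rightarrow> ('a::complex_banach \<Rightarrow> 'a) \<Rightarrow> bool" where
  "zero_of_order n \<mu> \<longleftrightarrow>
     (\<exists>Q. homogeneous_expansion \<mu> Q \<and> (\<forall>j<n. \<forall>x. Q j x = 0) \<and> (\<exists>x. Q n x \<noteq> 0))"

definition \<Psi>\<^sub>4 :: "nat \<Rightarrow> nat \<Rightarrow> real \<Rightarrow> real \<Rightarrow> real \<Rightarrow> real \<Rightarrow> real" where
  "\<Psi>\<^sub>4 k m p lam a r =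
     (1 + a * r ^ m) powr p * (1 + (lam * a\<^sup>2 - lam - 1) * r ^ k) - (1 - r ^ k) * (a + r ^ m) powr p"

definition bohr_functional ::
    "nat \<Rightarrow> nat \<Rightarrow> real \<Rightarrow> real \<Rightarrow> real \<Rightarrow> ('a::complex_banach \<Rightarrow> complex) \<Rightarrow> (nat \<Rightarrow> 'a \<Rightarrow> complex) \<Rightarrow>
     (nat \<Rightarrow> 'a \<Rightarrow> 'a) \<Rightarrow> 'a \<Rightarrow> real" where
  "bohr_functional k m p lam a f P \<mu> z =
     cmod (f (\<mu> m z)) powr p
     + lam * ((\<Sum>j. cmod (P (Suc j) (\<mu> k z)))
            + (1 / (1 + a) + norm z ^ k / (1 - norm z ^ k))
              * (\<Sum>j. (cmod (P (Suc j) (\<mu> k z)))\<^sup>2))"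

text \<open>Convergence of the two series in \<^const>\<open>bohr_functional\<close>. It is stated explicitly
  because \<^const>\<open>suminf\<close> has an arbitrary value on divergent series.\<close>

definition bohr_series_converge ::
    "nat \<Rightarrow> (nat \<Rightarrow> 'a::complex_banach \<Rightarrow> complex) \<Rightarrow> (nat \<Rightarrow> 'a \<Rightarrow> 'a) \<Rightarrow> 'a \<Rightarrow> bool" where
  "bohr_series_converge k P \<mu> z \<longleftrightarrow>
     summable (\<lambda>j. cmod (P (Suc j) (\<mu> k z))) \<and>
     summable (\<lambda>j. (cmod (P (Suc j) (\<mu> k z)))\<^sup>2)"

definition admissible_data ::
    "real \<Rightarrow> ('a::complex_banach \<Rightarrow> complex) \<Rightarrow> (nat \<Rightarrow> 'a \<Rightarrow> complex) \<Rightarrow> (nat \<Rightarrow> 'a \<Rightarrow> 'a) \<Rightarrow> bool" where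
  "admissible_data a f P \<mu> \<longleftrightarrow>
     holomorphic_map_on f (ball 0 1) \<and> f ` ball 0 1 \<subseteq> ball 0 1 \<and>
     homogeneous_expansion f P \<and> cmod (f 0) = a \<and>
     (\<forall>n\<ge>1. schwarz_map (\<mu> n) \<and> zero_of_order n (\<mu> n))"

end

theory Submission
  imports Defs "HOL-Complex_Analysis.Complex_Analysis"
begin

text \<open>
  On a slice through a unit vector, \<open>f\<close> is a power series \<open>\<Sum>b\<^sub>j\<zeta>\<^sup>j\<close> bounded by \<open>1\<close> on the unit disc.
  Since multiplication by such a series is a contraction of the Hardy space, a suitable test
  polynomial yields Carlson's inequalities
  \<open>\<bar>b\<^bsub>2n+1\<^esub>\<bar> \<le> 1 - \<Sum>\<^bsub>j\<le>n\<^esub>\<bar>b\<^sub>j\<bar>\<^sup>2\<close> and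
  \<open>\<bar>b\<^bsub>2n\<^esub>\<bar> + \<bar>b\<^sub>n\<bar>\<^sup>2/(1 + \<bar>b\<^sub>0\<bar>) \<le> 1 - \<Sum>\<^bsub>j<n\<^esub>\<bar>b\<^sub>j\<bar>\<^sup>2\<close>. Summed against powers of
  \<open>\<rho> = r\<^sup>k\<close> they bound the bracket in \<open>I\<^sub>f\<close> by \<open>(1 - a\<^sup>2)\<rho>/(1 - \<rho>)\<close>. With the Schwarz--Pick
  estimate for \<open>f \<circ> \<mu>\<^sub>m\<close> this gives \<open>I\<^sub>f(z) \<le> A(r)\<close> with
  \<open>A(r) = ((a + r\<^sup>m)/(1 + ar\<^sup>m))\<^sup>p + \<lambda>(1 - a\<^sup>2)r\<^sup>k/(1 - r\<^sup>k)\<close>. This function is strictly increasing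
  and \<open>A(r) = 1\<close> is the equation \<open>\<Psi>\<^sub>4(r) = 0\<close>. For a norm-one functional \<open>l\<close> that attains its norm
  (Hahn--Banach), \<open>f = (a - l)/(1 - al)\<close> and \<open>\<mu>\<^sub>n(z) = -l(z)\<^bsup>n-1\<^esup>z\<close> turn all these estimates into
  equalities.
\<close>

section \<open>Coefficients of bounded power series\<close>

lemma sum_roots_of_unity_orthogonal:
  fixes M i j :: nat
  assumes "i < M" "j < M"
  defines "\<omega> \<equiv> \<lambda>l. cis (2 * pi * real l / real M)"
  shows "(\<Sum>l<M. \<omega> l ^ i * cnj (\<omega> l) ^ j) = (if i = j then of_nat M else 0)"
proof -
  have M: "M > 0" using assms by simp
  define z where "z = \<omega> i * cnj (\<omega> j)"
  have swap: "\<omega> l ^ i = \<omega> i ^ l" for i l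
    unfolding \<omega>_def Complex.DeMoivre by (rule arg_cong[of _ _ cis]) simp
  have pow: "\<omega> l ^ i * cnj (\<omega> l) ^ j = z ^ l" for l
    by (simp add: z_def power_mult_distrib swap[of l] flip: complex_cnj_power)
  have "\<omega> M = 1" using M by (simp add: \<omega>_def)
  then have zM: "z ^ M = 1"
    by (simp add: z_def power_mult_distrib swap[of _ M] flip: complex_cnj_power)
  show ?thesis
  proof (cases "i = j")
    case True
    then have "z = 1" by (simp add: z_def \<omega>_def cis_cnj cis_mult)
    then show ?thesis using True unfolding pow by simp
  next
    case False
    have "inj_on \<omega> {..<M}"
      using Complex.bij_betw_roots_unity[OF M] by (simp add: bij_betw_def \<omega>_def)
    then have "\<omega> i \<noteq> \<omega> j" using False assms by (auto dest: inj_onD)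
    moreover have "z * \<omega> j = \<omega> i"
      by (simp add: z_def \<omega>_def cis_cnj cis_mult)
    ultimately have "z \<noteq> 1" by auto
    then have "(\<Sum>l<M. z ^ l) = 0" using geometric_sum[of z M] zM by simp
    then show ?thesis using False unfolding pow by simp
  qed
qed

text \<open>With more nodes than the degree, orthogonality removes all cross terms, so the discrete
  mean square is exact. It takes the place of an integral over the circle of radius
  \<open>r\<close>.\<close>

lemma sum_norm_poly_roots_of_unity:
  fixes p :: "complex poly" and r :: real
  assumes "degree p < M"
  shows "(\<Sum>l<M. (cmod (poly p (of_real r * cis (2 * pi * real l / real M))))\<^sup>2) =
         real M * (\<Sum>i<M. (cmod (coeff p i))\<^sup>2 * r ^ (2 * i))"
proof -
  define \<omega> where "\<omega> = (\<lambda>l. cis (2 * pi * real l / real M))"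
  have p: "poly p x = (\<Sum>i<M. coeff p i * x ^ i)" for x
    unfolding poly_altdef using assms
    by (intro sum.mono_neutral_left) (auto simp: coeff_eq_0)
  let ?c = "\<lambda>i. coeff p i * of_real r ^ i"
  have sq: "(complex_of_real (cmod z))\<^sup>2 = z * cnj z" for z
    using complex_norm_square[of z] by simp
  have "complex_of_real (\<Sum>l<M. (cmod (poly p (of_real r * \<omega> l)))\<^sup>2) =
     (\<Sum>l<M. \<Sum>i<M. \<Sum>j<M. ?c i * cnj (?c j) * (\<omega> l ^ i * cnj (\<omega> l) ^ j))"
    by (simp add: sq p sum_product power_mult_distrib mult_ac)
  also have "\<dots> = (\<Sum>i<M. \<Sum>j<M. \<Sum>l<M. ?c i * cnj (?c j) * (\<omega> l ^ i * cnj (\<omega> l) ^ j))"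
    by (subst sum.swap, rule sum.cong[OF refl], rule sum.swap)
  also have "\<dots> = (\<Sum>i<M. \<Sum>j<M. ?c i * cnj (?c j) * (if i = j then of_nat M else 0))"
    unfolding sum_distrib_left[symmetric] \<omega>_def
    by (intro sum.cong refl arg_cong2[where f = "(*)"] sum_roots_of_unity_orthogonal) auto
  also have "\<dots> = (\<Sum>i<M. ?c i * cnj (?c i) * of_nat M)"
    by (intro sum.cong refl) (simp add: if_distrib[of "(*) _"] cong: if_cong)
  also have "\<dots> = complex_of_real (real M * (\<Sum>i<M. (cmod (coeff p i))\<^sup>2 * r ^ (2 * i)))"
    by (simp add: sum_distrib_left sq mult_2 mult_2_right power_add mult_ac)
  finally show ?thesis unfolding \<omega>_def of_real_eq_iff .
qed

text \<open>At each node the product is at most \<open>K\<close> times \<open>q\<close> in modulus,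
  and Parseval carries this over to coefficients. The cut at \<open>N\<close> drops nonnegative
  terms on the left and nothing on the right.\<close>

lemma poly_mult_coeff_contraction:
  fixes p q :: "complex poly" and r K :: real
  assumes K: "\<And>z. cmod z = r \<Longrightarrow> cmod (poly p z) \<le> K" and r: "r \<ge> 0" and dq: "degree q \<le> N"
  shows "(\<Sum>i\<le>N. (cmod (coeff (p * q) i))\<^sup>2 * r ^ (2 * i)) \<le>
         K\<^sup>2 * (\<Sum>i\<le>N. (cmod (coeff q i))\<^sup>2 * r ^ (2 * i))"
proof -
  \<comment> \<open>Large enough for one set of nodes to serve \<open>q\<close>,
    \<open>p * q\<close> and the cut at \<open>N\<close>.\<close>
  define M where "M = Suc (N + degree p + degree q)"
  define \<omega> where "\<omega> = (\<lambda>l. of_real r * cis (2 * pi * real l / real M))"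
  have cm: "cmod (\<omega> l) = r" for l using r by (simp add: \<omega>_def norm_mult)
  have M: "degree (p * q) < M" "degree q < M" "M > 0"
    using degree_mult_le[of p q] by (auto simp: M_def)
  have "(\<Sum>i\<le>N. (cmod (coeff (p * q) i))\<^sup>2 * r ^ (2 * i)) \<le>
        (\<Sum>i<M. (cmod (coeff (p * q) i))\<^sup>2 * r ^ (2 * i))"
    using r by (intro sum_mono2) (auto simp: M_def)
  also have "real M * \<dots> = (\<Sum>l<M. (cmod (poly (p * q) (\<omega> l)))\<^sup>2)"
    unfolding \<omega>_def by (rule sum_norm_poly_roots_of_unity[OF M(1), symmetric])
  also have "\<dots> \<le> (\<Sum>l<M. K\<^sup>2 * (cmod (poly q (\<omega> l)))\<^sup>2)"
    by (intro sum_mono) (auto simp: norm_mult power_mult_distrib intro!: mult_right_mono power_mono K cm)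
  also have "\<dots> = K\<^sup>2 * (real M * (\<Sum>i<M. (cmod (coeff q i))\<^sup>2 * r ^ (2 * i)))"
    unfolding \<omega>_def sum_distrib_left[symmetric]
    by (subst sum_norm_poly_roots_of_unity[OF M(2)]) simp
  also have "(\<Sum>i<M. (cmod (coeff q i))\<^sup>2 * r ^ (2 * i)) = (\<Sum>i\<le>N. (cmod (coeff q i))\<^sup>2 * r ^ (2 * i))"
    using dq by (intro sum.mono_neutral_right) (auto simp: M_def coeff_eq_0)
  finally show ?thesis using M(3) by (simp add: mult.left_commute)
qed

section \<open>Compression of multiplication by a bounded series\<close>

locale bounded_power_series =
  fixes b :: "nat \<Rightarrow> complex" and g :: "complex \<Rightarrow> complex"
  assumes sums: "cmod \<zeta> < 1 \<Longrightarrow> (\<lambda>j. b j * \<zeta> ^ j) sums g \<zeta>"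
    and bounded: "cmod \<zeta> < 1 \<Longrightarrow> cmod (g \<zeta>) \<le> 1"
begin

lemma conv_radius_ge_1: "conv_radius b \<ge> 1"
proof (rule conv_radius_geI_ex)
  fix r :: real assume "0 < r" "ereal r < 1"
  then show "\<exists>z. norm z = r \<and> summable (\<lambda>n. b n * z ^ n)"
    using sums[of "of_real r"] by (intro exI[of _ "of_real r"]) (auto simp: sums_iff)
qed

text \<open>Uniform convergence on \<open>cball 0 r\<close> brings a partial sum within
  \<open>1 - r\<close> of \<open>g\<close>; the resulting bound \<open>2 - r\<close> tends to 1 as
  \<open>r\<close> does. The demand \<open>N < L\<close> keeps the first \<open>N + 1\<close>
  coefficients intact.\<close>

lemma partial_sum_bound:
  assumes "0 < r" "r < 1"
  obtains L where "N < L" "\<And>z. cmod z = r \<Longrightarrow> cmod (\<Sum>i<L. b i * z ^ i) \<le> 2 - r"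
proof -
  have "ereal r < conv_radius b"
    using conv_radius_ge_1 assms less_le_trans[of "ereal r" 1 "conv_radius b"] by simp
  from powser_uniform_limit[OF this, of 0]
  have "\<forall>\<^sub>F n in sequentially. \<forall>x\<in>cball 0 r. dist (\<Sum>i<n. b i * x ^ i) (\<Sum>i. b i * x ^ i) < 1 - r"
    using assms by (auto simp: uniform_limit_iff)
  then obtain L0 where L0: "\<And>n x. n \<ge> L0 \<Longrightarrow> x \<in> cball 0 r \<Longrightarrow>
      dist (\<Sum>i<n. b i * x ^ i) (\<Sum>i. b i * x ^ i) < 1 - r"
    unfolding eventually_sequentially by blast
  show thesis
  proof (rule that[of "max L0 (Suc N)"])
    fix z :: complex assume z: "cmod z = r"
    let ?S = "\<Sum>i<max L0 (Suc N). b i * z ^ i"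
    have "(\<Sum>i. b i * z ^ i) = g z" using sums[of z] z assms by (simp add: sums_iff)
    then have "cmod (?S - g z) < 1 - r" using L0[of "max L0 (Suc N)" z] z by (simp add: dist_norm)
    moreover have "cmod (g z) \<le> 1" using bounded z assms by simp
    ultimately show "cmod ?S \<le> 2 - r" using norm_triangle_sub[of ?S "g z"] by linarith
  qed simp
qed

text \<open>Multiplication by \<open>g\<close> is a contraction of the Hardy space; this is its compression to the
  first \<open>N + 1\<close> coefficients.\<close>

lemma coeff_contraction:
  "(\<Sum>l\<le>N. (cmod (\<Sum>i\<le>l. b (l - i) * q i))\<^sup>2) \<le> (\<Sum>i\<le>N. (cmod (q i))\<^sup>2)"
proof -
  define c where "c = (\<lambda>l. \<Sum>i\<le>l. b (l - i) * q i)"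
  \<comment> \<open>With a partial sum in place of \<open>g\<close> the polynomial estimate applies
    at radius \<open>r < 1\<close>. Both sides are polynomials in \<open>r\<close>, so
    \<open>r\<close> may tend to 1 afterwards.\<close>
  have ineq: "(\<Sum>l\<le>N. (cmod (c l))\<^sup>2 * r ^ (2 * l)) \<le> (2 - r)\<^sup>2 * (\<Sum>i\<le>N. (cmod (q i))\<^sup>2 * r ^ (2 * i))"
    if r: "0 < r" "r < 1" for r :: real
  proof -
    obtain L where L: "N < L" "\<And>z. cmod z = r \<Longrightarrow> cmod (\<Sum>i<L. b i * z ^ i) \<le> 2 - r"
      using partial_sum_bound[OF r] by blast
    define P where "P = (\<Sum>i<L. monom (b i) i)"
    define Q where "Q = (\<Sum>i\<le>N. monom (q i) i)"
    have P: "coeff P i = (if i < L then b i else 0)" for i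
      by (simp add: P_def coeff_sum)
    have Q: "coeff Q i = (if i \<le> N then q i else 0)" for i
      by (simp add: Q_def coeff_sum)
    have "degree Q \<le> N" by (rule degree_le) (simp add: Q)
    moreover have "cmod (poly P z) \<le> 2 - r" if "cmod z = r" for z
      using L(2)[OF that] by (simp add: P_def poly_sum poly_monom)
    ultimately have "(\<Sum>i\<le>N. (cmod (coeff (P * Q) i))\<^sup>2 * r ^ (2 * i)) \<le>
         (2 - r)\<^sup>2 * (\<Sum>i\<le>N. (cmod (coeff Q i))\<^sup>2 * r ^ (2 * i))"
      using r by (intro poly_mult_coeff_contraction) auto
    \<comment> \<open>As \<open>N < L\<close>, the cut of \<open>b\<close> at \<open>L\<close> does
      not affect the coefficients up to \<open>N\<close>.\<close>
    moreover have "coeff (P * Q) l = c l" if "l \<le> N" for l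
      unfolding mult.commute[of P Q] coeff_mult c_def P Q using that L(1)
      by (intro sum.cong) (auto simp: mult.commute)
    ultimately show ?thesis by (simp add: Q)
  qed
  have lim: "((\<lambda>r. \<Sum>i\<le>N. u i * r ^ (2 * i)) \<longlongrightarrow> (\<Sum>i\<le>N. u i * 1 ^ (2 * i))) (at_left 1)" for u :: "nat \<Rightarrow> real"
    by (intro tendsto_intros)
  have "(\<Sum>l\<le>N. (cmod (c l))\<^sup>2 * 1 ^ (2 * l)) \<le> (2 - 1)\<^sup>2 * (\<Sum>i\<le>N. (cmod (q i))\<^sup>2 * 1 ^ (2 * i))"
  proof (rule tendsto_le[of "at_left (1::real)"])
    show "\<forall>\<^sub>F r in at_left (1::real). (\<Sum>l\<le>N. (cmod (c l))\<^sup>2 * r ^ (2 * l)) \<le>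
        (2 - r)\<^sup>2 * (\<Sum>i\<le>N. (cmod (q i))\<^sup>2 * r ^ (2 * i))"
      unfolding eventually_at_left_field by (intro exI[of _ 0]) (auto intro!: ineq)
    show "((\<lambda>r. (2 - r)\<^sup>2 * (\<Sum>i\<le>N. (cmod (q i))\<^sup>2 * r ^ (2 * i))) \<longlongrightarrow>
        (2 - 1)\<^sup>2 * (\<Sum>i\<le>N. (cmod (q i))\<^sup>2 * 1 ^ (2 * i))) (at_left 1)"
      by (intro tendsto_mult tendsto_power tendsto_diff tendsto_const tendsto_ident_at lim)
  qed (simp_all add: lim[simplified])
  then show ?thesis by (simp add: c_def)
qed

text \<open>The contraction applied to the constant series 1.\<close>

lemma sum_coeff_le_1: "(\<Sum>l\<le>N. (cmod (b l))\<^sup>2) \<le> 1"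
proof -
  have "(\<Sum>i\<le>l. b (l - i) * (if i = 0 then 1 else 0)) = b l" for l
    by (simp add: if_distrib[of "(*) _"] cong: if_cong)
  moreover have "(\<Sum>i\<le>N. (cmod (if i = 0 then 1 else 0))\<^sup>2) = 1"
    by (simp add: if_distrib[of cmod] if_distrib[of "\<lambda>x. x\<^sup>2"] cong: if_cong)
  ultimately show ?thesis
    using coeff_contraction[of "\<lambda>i. if i = 0 then 1 else 0" N] by simp
qed

lemma norm_coeff_le_1: "cmod (b l) \<le> 1"
proof -
  have "(cmod (b l))\<^sup>2 \<le> (\<Sum>i\<le>l. (cmod (b i))\<^sup>2)" by (intro member_le_sum) auto
  also have "\<dots> \<le> 1\<^sup>2" using sum_coeff_le_1[of l] by simp
  finally show ?thesis by (rule power2_le_imp_le) simp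
qed

end

section \<open>Carlson's inequalities\<close>

lemma sum_greaterThanAtMost_diff_rev:
  fixes F :: "nat \<Rightarrow> 'b::comm_monoid_add"
  shows "(\<Sum>i\<in>{m<..N}. F (N - i)) = (\<Sum>j<N - m. F j)"
  by (rule sum.reindex_bij_witness[of _ "\<lambda>j. N - j" "\<lambda>i. N - i"]) auto

lemma norm_le_one_minus_if_completed_square:
  fixes \<beta> :: complex and \<sigma> :: real
  assumes ineq: "\<And>t. (cmod (\<beta> + t * of_real \<sigma>))\<^sup>2 \<le> 1 - \<sigma> + (cmod t)\<^sup>2 * \<sigma>" and "\<sigma> \<le> 1"
  shows "cmod \<beta> \<le> 1 - \<sigma>"
proof (cases "\<sigma> = 1")
  case True
  have "(cmod (\<beta> + \<beta>))\<^sup>2 \<le> (cmod \<beta>)\<^sup>2" using ineq[of \<beta>] True by simp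
  moreover have "cmod (\<beta> + \<beta>) = 2 * cmod \<beta>" by (simp flip: mult_2 add: norm_mult)
  ultimately show ?thesis using True by (simp add: power_mult_distrib)
next
  case False
  then have \<sigma>: "1 - \<sigma> > 0" using assms(2) by simp
  define t where "t = \<beta> / of_real (1 - \<sigma>)"
  have nt: "cmod t = cmod \<beta> / (1 - \<sigma>)" unfolding t_def norm_divide norm_of_real using \<sigma> by simp
  have "of_real (1 - \<sigma>) * t = \<beta>" using \<sigma> unfolding t_def by (simp del: of_real_diff)
  then have "\<beta> + t * of_real \<sigma> = t" by (simp add: algebra_simps)
  then have "(cmod t)\<^sup>2 * (1 - \<sigma>) \<le> 1 - \<sigma>" using ineq[of t] by (simp add: algebra_simps)
  then have "(cmod t)\<^sup>2 \<le> 1\<^sup>2" using \<sigma> by simp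
  then have "cmod t \<le> 1" by (rule power2_le_imp_le) simp
  then show ?thesis using \<sigma> by (simp add: nt)
qed

context bounded_power_series
begin

text \<open>The contraction is applied to a test polynomial \<open>q\<close>, and only the
  coefficients below \<open>m\<close>, at \<open>m\<close> and at \<open>N\<close> are kept;
  \<open>w\<close> and \<open>t\<close> stay free for optimisation. For \<open>m = 0\<close> the
  terms 1 and \<open>w\<close> of \<open>q\<close> share an index and their squares would not simply
  add, hence \<open>w = 0\<close> there.\<close>

lemma coeff_test_inequality:
  assumes mN: "m < N" and m0: "m = 0 \<Longrightarrow> w = 0"
  defines "\<sigma> \<equiv> \<Sum>j<N - m. (cmod (b j))\<^sup>2"
  shows "(\<Sum>l<m. (cmod (b l))\<^sup>2) + (cmod (b m + b 0 * w))\<^sup>2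
           + (cmod (b N + b (N - m) * w + t * of_real \<sigma>))\<^sup>2
         \<le> 1 + (cmod w)\<^sup>2 + (cmod t)\<^sup>2 * \<sigma>"
proof -
  \<comment> \<open>The conjugated coefficients in reverse order make coefficient \<open>N\<close>
    of the product pick up \<open>t\<close> times the sum of squares
    \<open>\<sigma>\<close>.\<close>
  define q where "q = (\<lambda>i. (if i = 0 then 1 else 0) + (if i = m then w else 0)
      + (if m < i then t * cnj (b (N - i)) else 0))"
  define c where "c = (\<lambda>l. \<Sum>i\<le>l. b (l - i) * q i)"
  have "c l = b l + (if m \<le> l then b (l - m) * w else 0)
          + (\<Sum>i\<in>{m<..l}. b (l - i) * (t * cnj (b (N - i))))" for l
  proof -
    have "c l = (\<Sum>i\<le>l. b (l - i) * (if i = 0 then 1 else 0))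
       + (\<Sum>i\<le>l. b (l - i) * (if i = m then w else 0))
       + (\<Sum>i\<le>l. if m < i then b (l - i) * (t * cnj (b (N - i))) else 0)"
      unfolding c_def q_def by (simp add: algebra_simps sum.distrib if_distrib[of "(*) _"] cong: if_cong)
    also have "(\<Sum>i\<le>l. if m < i then b (l - i) * (t * cnj (b (N - i))) else 0) =
       (\<Sum>i\<in>{m<..l}. b (l - i) * (t * cnj (b (N - i))))"
      by (intro sum.mono_neutral_cong_right) auto
    finally show ?thesis by (simp add: if_distrib[of "(*) _"] cong: if_cong)
  qed
  note c = this
  have c1: "c l = b l" if "l < m" for l using that by (simp add: c)
  have c2: "c m = b m + b 0 * w" by (simp add: c)
  have "(\<Sum>i\<in>{m<..N}. b (N - i) * (t * cnj (b (N - i)))) = (\<Sum>j<N-m. b j * (t * cnj (b j)))"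
    by (rule sum_greaterThanAtMost_diff_rev[of "\<lambda>j. b j * (t * cnj (b j))"])
  also have "\<dots> = t * of_real \<sigma>"
    by (simp add: \<sigma>_def sum_distrib_left complex_norm_square mult_ac del: of_real_power)
  finally have c3: "c N = b N + b (N - m) * w + t * of_real \<sigma>"
    using mN by (simp add: c)
  have "(cmod (q i))\<^sup>2 = (if i = 0 then 1 else 0) + (if i = m then (cmod w)\<^sup>2 else 0)
      + (if m < i then (cmod t)\<^sup>2 * (cmod (b (N - i)))\<^sup>2 else 0)" for i
    using m0 by (auto simp: q_def norm_mult power_mult_distrib)
  then have "(\<Sum>i\<le>N. (cmod (q i))\<^sup>2) = 1 + (cmod w)\<^sup>2
      + (\<Sum>i\<le>N. if m < i then (cmod t)\<^sup>2 * (cmod (b (N - i)))\<^sup>2 else 0)"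
    using mN by (simp add: sum.distrib)
  also have "(\<Sum>i\<le>N. if m < i then (cmod t)\<^sup>2 * (cmod (b (N - i)))\<^sup>2 else 0) =
      (\<Sum>i\<in>{m<..N}. (cmod t)\<^sup>2 * (cmod (b (N - i)))\<^sup>2)"
    by (intro sum.mono_neutral_cong_right) auto
  also have "\<dots> = (\<Sum>j<N - m. (cmod t)\<^sup>2 * (cmod (b j))\<^sup>2)"
    by (rule sum_greaterThanAtMost_diff_rev[of "\<lambda>j. (cmod t)\<^sup>2 * (cmod (b j))\<^sup>2"])
  finally have q: "(\<Sum>i\<le>N. (cmod (q i))\<^sup>2) = 1 + (cmod w)\<^sup>2 + (cmod t)\<^sup>2 * \<sigma>"
    by (simp add: \<sigma>_def sum_distrib_left)
  have "(\<Sum>l<m. (cmod (b l))\<^sup>2) + (cmod (c m))\<^sup>2 + (cmod (c N))\<^sup>2 =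
      (\<Sum>l\<in>insert N (insert m {..<m}). (cmod (c l))\<^sup>2)"
    using mN by (simp add: c1)
  also have "\<dots> \<le> (\<Sum>l\<le>N. (cmod (c l))\<^sup>2)"
    using mN by (intro sum_mono2) auto
  also have "\<dots> \<le> (\<Sum>i\<le>N. (cmod (q i))\<^sup>2)"
    unfolding c_def by (rule coeff_contraction)
  finally show ?thesis unfolding c2 c3 q .
qed

text \<open>With \<open>m = n\<close>, \<open>N = 2 * n + 1\<close> and \<open>w = 0\<close>, the
  sum \<open>\<sigma>\<close> over \<open>j < N - m\<close> coincides with the sum of the retained
  squares up to index \<open>m\<close>; then \<open>t\<close> is optimised.\<close>

lemma carlson_odd: "cmod (b (2 * n + 1)) \<le> 1 - (\<Sum>j\<le>n. (cmod (b j))\<^sup>2)"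
proof -
  define \<sigma> where "\<sigma> = (\<Sum>j\<le>n. (cmod (b j))\<^sup>2)"
  have \<sigma>: "(\<Sum>j<2 * n + 1 - n. (cmod (b j))\<^sup>2) = \<sigma>" "(\<Sum>j<n. (cmod (b j))\<^sup>2) + (cmod (b n))\<^sup>2 = \<sigma>"
    by (simp_all add: \<sigma>_def flip: lessThan_Suc_atMost)
  have "(cmod (b (2 * n + 1) + t * of_real \<sigma>))\<^sup>2 \<le> 1 - \<sigma> + (cmod t)\<^sup>2 * \<sigma>" for t
    using coeff_test_inequality[of n "2 * n + 1" 0 t] unfolding \<sigma> by (simp add: \<sigma>)
  moreover have "\<sigma> \<le> 1" unfolding \<sigma>_def by (rule sum_coeff_le_1)
  ultimately show ?thesis unfolding \<sigma>_def[symmetric] by (rule norm_le_one_minus_if_completed_square)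
qed

text \<open>Here \<open>m = n\<close> and \<open>N = 2 * n\<close>, so \<open>w\<close> multiplies
  \<open>b n\<close> in the last coefficient. It is chosen such that coefficient \<open>n\<close> of
  the product is at least \<open>cmod w\<close> in modulus, which cancels the square of
  \<open>cmod w\<close> on the right.\<close>

lemma carlson_even:
  assumes n: "n \<ge> 1"
  shows "cmod (b (2 * n)) + (cmod (b n))\<^sup>2 / (1 + cmod (b 0)) \<le> 1 - (\<Sum>j<n. (cmod (b j))\<^sup>2)"
proof -
  define \<sigma> where "\<sigma> = (\<Sum>j<n. (cmod (b j))\<^sup>2)"
  define a y where "a = cmod (b 0)" and "y = cmod (b n)"
  have a: "1 + a > 0" by (simp add: a_def add_pos_nonneg)
  \<comment> \<open>The phase of \<open>w\<close> aligns \<open>b n * w\<close> with \<open>b (2 * n)\<close>; its modulus \<open>y / (1 + a)\<close> is the solution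
    of \<open>y - a * \<bar>w\<bar> = \<bar>w\<bar>\<close>.\<close>
  define e where "e = (if b (2 * n) = 0 then 1 else sgn (b (2 * n)))"
  \<comment> \<open>Since \<open>sgn 0 = 0\<close>, the value 1 is prescribed for a vanishing
    \<open>b (2 * n)\<close> to keep \<open>e\<close> unimodular.\<close>
  have e: "cmod e = 1" "b (2 * n) = of_real (cmod (b (2 * n))) * e"
    by (auto simp: e_def norm_sgn) (simp add: sgn_eq)
  define w where "w = of_real (1 / (1 + a)) * cnj (b n) * e"
  have nw: "cmod w = y / (1 + a)"
    using a by (simp add: w_def norm_mult e(1) y_def norm_divide del: of_real_add of_real_divide)
  have "b n * w = of_real (y\<^sup>2 / (1 + a)) * e"
    by (simp add: w_def y_def complex_norm_square del: of_real_power of_real_add)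
  with e(2) have "b (2 * n) + b n * w = of_real (cmod (b (2 * n))) * e + of_real (y\<^sup>2 / (1 + a)) * e"
    by (rule arg_cong2[of _ _ _ _ "(+)"])
  then have "b (2 * n) + b n * w = of_real (cmod (b (2 * n)) + y\<^sup>2 / (1 + a)) * e"
    unfolding of_real_add distrib_right .
  then have n\<beta>: "cmod (b (2 * n) + b n * w) = cmod (b (2 * n)) + y\<^sup>2 / (1 + a)"
    using a by (simp add: norm_mult e(1) del: of_real_add)
  have "y - a * cmod w \<le> cmod (b n + b 0 * w)"
    using norm_diff_ineq[of "b n" "b 0 * w"] by (simp add: y_def a_def norm_mult)
  moreover have "y - a * cmod w = cmod w" using a by (simp add: nw field_simps)
  ultimately have sq: "(cmod w)\<^sup>2 \<le> (cmod (b n + b 0 * w))\<^sup>2" by (intro power_mono) auto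
  have "(cmod (b (2 * n) + b n * w + t * of_real \<sigma>))\<^sup>2 \<le> 1 - \<sigma> + (cmod t)\<^sup>2 * \<sigma>" for t
  proof -
    have "2 * n - n = n" by simp
    with coeff_test_inequality[of n "2 * n" w t] n
    have "\<sigma> + (cmod (b n + b 0 * w))\<^sup>2 + (cmod (b (2 * n) + b n * w + t * of_real \<sigma>))\<^sup>2
        \<le> 1 + (cmod w)\<^sup>2 + (cmod t)\<^sup>2 * \<sigma>"
      by (simp only: flip: \<sigma>_def)
    then show ?thesis using sq by linarith
  qed
  moreover have "\<sigma> \<le> 1"
  proof -
    have "\<sigma> \<le> (\<Sum>j\<le>n. (cmod (b j))\<^sup>2)" unfolding \<sigma>_def by (intro sum_mono2) auto
    then show ?thesis using sum_coeff_le_1[of n] by linarith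
  qed
  ultimately have "cmod (b (2 * n) + b n * w) \<le> 1 - \<sigma>"
    by (rule norm_le_one_minus_if_completed_square)
  then show ?thesis unfolding n\<beta> by (simp add: \<sigma>_def a_def y_def)
qed

section \<open>Summation of Carlson's inequalities\<close>

text \<open>The subtracted remainder on the right makes the induction close. A step adds the indices
  \<open>2 * n + 2\<close> and \<open>2 * n + 3\<close> to the first sum but only
  \<open>n + 1\<close> to the second. The even inequality absorbs the
  \<open>1 / (1 + cmod (b 0))\<close> part of the new square; what is left is exactly the decrease
  of the remainder.\<close>

lemma bohr_partial_sums:
  fixes \<rho> :: real
  assumes \<rho>: "0 \<le> \<rho>" "\<rho> < 1"
  shows "(\<Sum>j<2 * n + 1. cmod (b (Suc j)) * \<rho> ^ Suc j)
      + (1 / (1 + cmod (b 0)) + \<rho> / (1 - \<rho>)) * (\<Sum>j<n. (cmod (b (Suc j)) * \<rho> ^ Suc j)\<^sup>2)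
    \<le> ((1 - (cmod (b 0))\<^sup>2) * \<rho> - \<rho> ^ (2 * n + 2) * (1 - (\<Sum>j\<le>n. (cmod (b j))\<^sup>2))) / (1 - \<rho>)"
proof (induction n)
  case 0
  have "cmod (b 1) * \<rho> \<le> (1 - (cmod (b 0))\<^sup>2) * \<rho>"
    using carlson_odd[of 0] \<rho> by (intro mult_right_mono) auto
  also have "\<dots> = ((1 - (cmod (b 0))\<^sup>2) * \<rho> - \<rho>\<^sup>2 * (1 - (cmod (b 0))\<^sup>2)) / (1 - \<rho>)"
    using \<rho> by (simp add: field_simps power2_eq_square)
  finally show ?case by (simp add: power2_eq_square[of \<rho>])
next
  case (Suc n)
  \<comment> \<open>\<open>S\<close> and \<open>S + y\<^sup>2\<close> are the new and the old
    remainder factors; \<open>r\<close> is the power of \<open>\<rho>\<close> at index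
    \<open>2 * n + 2\<close>.\<close>
  define a S y r where "a = cmod (b 0)" and "S = 1 - (\<Sum>j\<le>Suc n. (cmod (b j))\<^sup>2)"
    and "y = cmod (b (Suc n))" and "r = \<rho> ^ (2 * n + 2)"
  have Sy: "1 - (\<Sum>j\<le>n. (cmod (b j))\<^sup>2) = S + y\<^sup>2" by (simp add: S_def y_def)
  have "cmod (b (2 * Suc n)) \<le> S + y\<^sup>2 - y\<^sup>2 / (1 + a)"
    using carlson_even[of "Suc n"] unfolding lessThan_Suc_atMost Sy a_def y_def by simp
  then have even: "cmod (b (2 * n + 2)) * r \<le> (S + y\<^sup>2 - y\<^sup>2 / (1 + a)) * r"
    using \<rho> by (intro mult_right_mono) (auto simp: r_def)
  have "cmod (b (2 * Suc n + 1)) \<le> S"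
    using carlson_odd[of "Suc n"] by (simp add: S_def)
  then have odd: "cmod (b (2 * n + 3)) * (r * \<rho>) \<le> S * (r * \<rho>)"
    using \<rho> by (intro mult_right_mono) (auto simp: r_def eval_nat_numeral)
  have pw: "\<rho> ^ (2 * n + 3) = r * \<rho>" "\<rho> ^ (2 * Suc n + 2) = r * \<rho>\<^sup>2" "(\<rho> ^ Suc n)\<^sup>2 = r"
    by (simp_all add: r_def eval_nat_numeral power_add power_mult power_mult_distrib flip: power_mult)
  let ?C = "1 / (1 + a) + \<rho> / (1 - \<rho>)"
  let ?A = "\<Sum>j<2 * n + 1. cmod (b (Suc j)) * \<rho> ^ Suc j"
  let ?B = "\<Sum>j<n. (cmod (b (Suc j)) * \<rho> ^ Suc j)\<^sup>2"
  have "(\<Sum>j<2 * Suc n + 1. cmod (b (Suc j)) * \<rho> ^ Suc j) =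
      ?A + cmod (b (2 * n + 2)) * r + cmod (b (2 * n + 3)) * (r * \<rho>)"
    by (simp add: r_def eval_nat_numeral mult_ac)
  moreover have "(\<Sum>j<Suc n. (cmod (b (Suc j)) * \<rho> ^ Suc j)\<^sup>2) = ?B + y\<^sup>2 * r"
    by (simp add: power_mult_distrib y_def flip: pw(3))
  ultimately have "(\<Sum>j<2 * Suc n + 1. cmod (b (Suc j)) * \<rho> ^ Suc j)
      + ?C * (\<Sum>j<Suc n. (cmod (b (Suc j)) * \<rho> ^ Suc j)\<^sup>2)
    \<le> (?A + ?C * ?B) + (S + y\<^sup>2 - y\<^sup>2 / (1 + a)) * r + S * (r * \<rho>) + ?C * (y\<^sup>2 * r)"
    using even odd by (simp add: distrib_left)
  also have "\<dots> \<le> ((1 - a\<^sup>2) * \<rho> - r * (S + y\<^sup>2)) / (1 - \<rho>)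
      + (S + y\<^sup>2 - y\<^sup>2 / (1 + a)) * r + S * (r * \<rho>) + ?C * (y\<^sup>2 * r)"
    using Suc.IH unfolding a_def[symmetric] r_def[symmetric] Sy by (intro add_right_mono) 
  \<comment> \<open>The two terms with \<open>y\<^sup>2 / (1 + a)\<close> cancel.\<close>
  also have "\<dots> = ((1 - a\<^sup>2) * \<rho> - r * (S + y\<^sup>2)) / (1 - \<rho>)
      + ((S + y\<^sup>2) * r + S * (r * \<rho>) + \<rho> / (1 - \<rho>) * (y\<^sup>2 * r))"
    by (simp add: algebra_simps)
  also have "(S + y\<^sup>2) * r + S * (r * \<rho>) + \<rho> / (1 - \<rho>) * (y\<^sup>2 * r) =
      (S * r - S * r * \<rho>\<^sup>2 + y\<^sup>2 * r) / (1 - \<rho>)"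
    using \<rho> by (simp add: field_simps power2_eq_square)
  also have "((1 - a\<^sup>2) * \<rho> - r * (S + y\<^sup>2)) / (1 - \<rho>) + (S * r - S * r * \<rho>\<^sup>2 + y\<^sup>2 * r) / (1 - \<rho>)
      = ((1 - a\<^sup>2) * \<rho> - r * \<rho>\<^sup>2 * S) / (1 - \<rho>)"
    by (simp add: algebra_simps flip: add_divide_distrib)
  finally show ?case unfolding a_def[symmetric] pw(2) S_def[symmetric] .
qed

lemma bohr_summable:
  fixes \<rho> :: real
  assumes \<rho>: "0 \<le> \<rho>" "\<rho> < 1"
  shows "summable (\<lambda>j. cmod (b (Suc j)) * \<rho> ^ Suc j)"
    and "summable (\<lambda>j. (cmod (b (Suc j)) * \<rho> ^ Suc j)\<^sup>2)"
proof -
  have s: "summable (\<lambda>j. \<rho> ^ Suc j)" unfolding summable_Suc_iff using \<rho> by (intro summable_geometric) auto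
  have le: "0 \<le> cmod (b (Suc j)) * \<rho> ^ Suc j" "cmod (b (Suc j)) * \<rho> ^ Suc j \<le> \<rho> ^ Suc j"
      "\<rho> ^ Suc j \<le> 1" for j
    using \<rho> norm_coeff_le_1[of "Suc j"] by (auto intro: mult_left_le_one_le power_le_one simp del: power_Suc)
  show 1: "summable (\<lambda>j. cmod (b (Suc j)) * \<rho> ^ Suc j)"
    using le by (intro summable_comparison_test'[OF s, of 0]) (auto simp del: power_Suc)
  show "summable (\<lambda>j. (cmod (b (Suc j)) * \<rho> ^ Suc j)\<^sup>2)"
  proof (rule summable_comparison_test'[OF 1, of 0])
    fix j
    show "norm ((cmod (b (Suc j)) * \<rho> ^ Suc j)\<^sup>2) \<le> cmod (b (Suc j)) * \<rho> ^ Suc j"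
      using le[of j] by (simp add: power2_eq_square mult_left_le_one_le order.trans[OF le(2,3)] del: power_Suc)
  qed
qed

text \<open>The remainder in \<open>bohr_partial_sums\<close> is nonnegative and is dropped. Cutting
  the first sum from \<open>2 * n + 1\<close> to \<open>n\<close> terms lets both partial sums pass
  to the limit together.\<close>

lemma bohr_inequality:
  fixes \<rho> :: real
  assumes \<rho>: "0 \<le> \<rho>" "\<rho> < 1"
  shows "(\<Sum>j. cmod (b (Suc j)) * \<rho> ^ Suc j)
      + (1 / (1 + cmod (b 0)) + \<rho> / (1 - \<rho>)) * (\<Sum>j. (cmod (b (Suc j)) * \<rho> ^ Suc j)\<^sup>2)
    \<le> (1 - (cmod (b 0))\<^sup>2) * \<rho> / (1 - \<rho>)"
proof (rule LIMSEQ_le_const2)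
  let ?C = "1 / (1 + cmod (b 0)) + \<rho> / (1 - \<rho>)"
  show "(\<lambda>n. (\<Sum>j<n. cmod (b (Suc j)) * \<rho> ^ Suc j) + ?C * (\<Sum>j<n. (cmod (b (Suc j)) * \<rho> ^ Suc j)\<^sup>2))
    \<longlonglongrightarrow> (\<Sum>j. cmod (b (Suc j)) * \<rho> ^ Suc j) + ?C * (\<Sum>j. (cmod (b (Suc j)) * \<rho> ^ Suc j)\<^sup>2)"
    by (intro tendsto_intros summable_LIMSEQ bohr_summable \<rho>)
  show "\<exists>N. \<forall>n\<ge>N. (\<Sum>j<n. cmod (b (Suc j)) * \<rho> ^ Suc j) + ?C * (\<Sum>j<n. (cmod (b (Suc j)) * \<rho> ^ Suc j)\<^sup>2)
      \<le> (1 - (cmod (b 0))\<^sup>2) * \<rho> / (1 - \<rho>)"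
  proof (intro exI[of _ 0] allI impI)
    fix n
    have "(\<Sum>j<n. cmod (b (Suc j)) * \<rho> ^ Suc j) \<le> (\<Sum>j<2 * n + 1. cmod (b (Suc j)) * \<rho> ^ Suc j)"
      using \<rho> by (intro sum_mono2) auto
    moreover have "((1 - (cmod (b 0))\<^sup>2) * \<rho> - \<rho> ^ (2 * n + 2) * (1 - (\<Sum>j\<le>n. (cmod (b j))\<^sup>2))) / (1 - \<rho>)
        \<le> (1 - (cmod (b 0))\<^sup>2) * \<rho> / (1 - \<rho>)"
      using \<rho> sum_coeff_le_1[of n] by (intro divide_right_mono) auto
    ultimately show "(\<Sum>j<n. cmod (b (Suc j)) * \<rho> ^ Suc j) + ?C * (\<Sum>j<n. (cmod (b (Suc j)) * \<rho> ^ Suc j)\<^sup>2)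
      \<le> (1 - (cmod (b 0))\<^sup>2) * \<rho> / (1 - \<rho>)"
      using bohr_partial_sums[OF \<rho>, of n] by linarith
  qed
qed

end

section \<open>Schwarz lemmas\<close>

text \<open>The squared modulus of the numerator is that of the denominator minus
  \<open>\<kappa>\<close>, and \<open>\<kappa>\<close> is unchanged when \<open>h\<close> and
  \<open>w\<close> are replaced by their moduli. This replacement enlarges the denominator from
  \<open>D\<close> to \<open>E\<close>, so the quotient can only grow; it also increases with
  \<open>cmod h\<close>.\<close>

lemma norm_moebius_le:
  fixes w h :: complex
  assumes w: "cmod w < 1" and h: "cmod h \<le> s" and s: "s < 1"
  shows "cmod ((h + w) / (1 + cnj w * h)) \<le> (cmod w + s) / (1 + cmod w * s)"
proof -
  define D E \<kappa> where "D = cmod (1 + cnj w * h)" and "E = 1 + cmod w * cmod h"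
    and "\<kappa> = (1 - (cmod h)\<^sup>2) * (1 - (cmod w)\<^sup>2)"
  have h1: "cmod h < 1" using h s by simp
  have lt: "cmod w * cmod h < 1"
    using w h1 by (metis mult_less_cancel_left2 mult_left_le norm_ge_zero less_eq_real_def
        le_less_trans)
  have DE: "D \<le> E" using norm_triangle_ineq[of 1 "cnj w * h"] by (simp add: D_def E_def norm_mult)
  have "1 - cmod w * cmod h \<le> D" using norm_diff_ineq[of 1 "cnj w * h"] by (simp add: D_def norm_mult)
  with lt have D: "D > 0" by linarith
  have E: "E > 0" using D DE by simp
  have \<kappa>: "\<kappa> \<ge> 0" using w h1 by (simp add: \<kappa>_def power_le_one)
  have 1: "(cmod (h + w))\<^sup>2 = D\<^sup>2 - \<kappa>"
    unfolding D_def \<kappa>_def cmod_power2 by (simp add: algebra_simps power2_eq_square)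
  have 2: "(cmod w + cmod h)\<^sup>2 = E\<^sup>2 - \<kappa>"
    by (simp add: E_def \<kappa>_def algebra_simps power2_eq_square)
  have "(cmod (h + w) * E)\<^sup>2 \<le> ((cmod w + cmod h) * D)\<^sup>2"
    using mult_left_mono[OF power_mono[OF DE, of 2] \<kappa>] D
    unfolding power_mult_distrib 1 2 by (simp add: algebra_simps)
  then have "cmod (h + w) * E \<le> (cmod w + cmod h) * D"
    by (rule power2_le_imp_le) (use D in auto)
  then have "cmod ((h + w) / (1 + cnj w * h)) \<le> (cmod w + cmod h) / E"
    unfolding norm_divide D_def[symmetric] using D E by (simp add: field_simps)
  also have "\<dots> \<le> (cmod w + s) / (1 + cmod w * s)"
  proof -
    have "(1 - (cmod w)\<^sup>2) * cmod h \<le> (1 - (cmod w)\<^sup>2) * s"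
      using w h by (intro mult_left_mono) (auto simp: power_le_one)
    moreover have "1 + cmod w * s > 0" using E h unfolding E_def
      by (smt (verit) mult_left_mono norm_ge_zero)
    ultimately show ?thesis using E by (simp add: E_def field_simps power2_eq_square)
  qed
  finally show ?thesis .
qed

text \<open>A Moebius map carrying \<open>g 0\<close> to 0 reduces the claim to the Schwarz lemma;
  undoing it leads to \<open>norm_moebius_le\<close> with \<open>s = cmod \<zeta>\<close>.\<close>

lemma schwarz_pick_growth:
  assumes hol: "g holomorphic_on ball 0 1" and g: "\<And>z. cmod z < 1 \<Longrightarrow> cmod (g z) < 1"
    and z: "cmod \<zeta> < 1"
  shows "cmod (g \<zeta>) \<le> (cmod (g 0) + cmod \<zeta>) / (1 + cmod (g 0) * cmod \<zeta>)"
proof -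
  define w where "w = g 0"
  have w: "cmod w < 1" using g[of 0] by (simp add: w_def)
  define h where "h = Moebius_function 0 w \<circ> g"
  have "h holomorphic_on ball 0 1"
    unfolding h_def by (rule holomorphic_on_compose_gen[OF hol Moebius_function_holomorphic[OF w]])
      (auto intro: g)
  moreover have "h 0 = 0" by (simp add: h_def w_def Moebius_function_eq_zero)
  moreover have h1: "cmod (h z) < 1" if "cmod z < 1" for z
    unfolding h_def o_def by (rule Moebius_function_norm_lt_1[OF w g[OF that]])
  ultimately have h: "cmod (h \<zeta>) \<le> cmod \<zeta>" by (rule Schwarz_Lemma(1)[OF _ _ _ z])
  have "Moebius_function 0 (- w) (h \<zeta>) = g \<zeta>"
    unfolding h_def o_def using w by (intro Moebius_function_compose g z) auto
  then have "g \<zeta> = (h \<zeta> + w) / (1 + cnj w * h \<zeta>)" by (simp add: Moebius_function_simple)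
  then show ?thesis using norm_moebius_le[OF w h z] by (simp add: w_def)
qed

context bounded_power_series
begin

lemma holomorphic: "g holomorphic_on ball 0 1"
  using power_series_holomorphic[of 0 1 b g] sums by simp

text \<open>Dividing \<open>g\<close> by the \<open>k\<close>-th power of the variable leaves a
  power series \<open>H\<close> on the disc. The maximum principle on the circle of radius
  \<open>r\<close> bounds \<open>H\<close> by \<open>1 / r ^ k\<close>, and \<open>r\<close> tends
  to 1.\<close>

lemma schwarz_order:
  assumes b: "\<And>j. j < k \<Longrightarrow> b j = 0" and z: "cmod \<zeta> < 1"
  shows "cmod (g \<zeta>) \<le> cmod \<zeta> ^ k"
proof -
  define H where "H = (\<lambda>z. \<Sum>j. b (j + k) * z ^ j)"
  have H: "(\<lambda>j. b (j + k) * z ^ j) sums H z" "g z = z ^ k * H z" if "cmod z < 1" for z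
  proof -
    show s: "(\<lambda>j. b (j + k) * z ^ j) sums H z"
    proof (cases "z = 0")
      case True
      then show ?thesis unfolding H_def by (intro summable_sums) (simp add: summable_0_powser)
    next
      case False
      have "summable (\<lambda>j. b (j + k) * z ^ (j + k))"
        using sums[OF that] summable_iff_shift[of "\<lambda>j. b j * z ^ j" k] by (simp add: sums_iff)
      then have "summable (\<lambda>j. (b (j + k) * z ^ j) * z ^ k)" by (simp add: power_add mult_ac)
      from summable_mult2[OF this, of "inverse (z ^ k)"]
      have "summable (\<lambda>j. b (j + k) * z ^ j)" using False by (simp add: mult.assoc)
      then show ?thesis unfolding H_def by (rule summable_sums)
    qed
    have "(\<lambda>j. b (j + k) * z ^ (j + k)) sums (g z - (\<Sum>j<k. b j * z ^ j))"
      using sums[OF that] by (rule sums_split_initial_segment)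
    then have "(\<lambda>j. z ^ k * (b (j + k) * z ^ j)) sums g z" by (simp add: b power_add mult_ac)
    moreover have "(\<lambda>j. z ^ k * (b (j + k) * z ^ j)) sums (z ^ k * H z)" by (rule sums_mult[OF s])
    ultimately show "g z = z ^ k * H z" by (rule sums_unique2)
  qed
  have hol: "H holomorphic_on ball 0 1"
    using power_series_holomorphic[of 0 1 "\<lambda>j. b (j + k)" H] H(1) by simp
  have "cmod (H \<zeta>) * r ^ k \<le> 1" if r: "cmod \<zeta> < r" "r < 1" for r
  proof -
    have r0: "r > 0" using r(1) by (rule le_less_trans[OF norm_ge_zero])
    have "cmod (H \<zeta>) \<le> 1 / r ^ k"
    proof (rule maximum_modulus_frontier[of H "cball 0 r"])
      show "H holomorphic_on interior (cball 0 r)"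
        using r by (intro holomorphic_on_subset[OF hol]) auto
      show "continuous_on (closure (cball 0 r)) H"
        using r by (intro continuous_on_subset[OF holomorphic_on_imp_continuous_on[OF hol]]) auto
      show "cmod (H z) \<le> 1 / r ^ k" if "z \<in> frontier (cball 0 r)" for z
      proof -
        have z: "cmod z = r" using that by (simp add: dist_norm)
        then show ?thesis using H(2)[of z] bounded[of z] r r0 by (simp add: norm_mult norm_power field_simps)
      qed
    qed (use r in auto)
    then show ?thesis using r0 by (simp add: field_simps)
  qed
  then have "\<forall>\<^sub>F r in at_left 1. cmod (H \<zeta>) * r ^ k \<le> 1"
    unfolding eventually_at_left_field using z by blast
  moreover have "((\<lambda>r. cmod (H \<zeta>) * r ^ k) \<longlongrightarrow> cmod (H \<zeta>) * 1 ^ k) (at_left 1)"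
    by (intro tendsto_intros)
  ultimately have "cmod (H \<zeta>) * 1 ^ k \<le> 1" by (intro tendsto_upperbound) auto
  then show ?thesis using H(2)[OF z] by (simp add: norm_mult norm_power mult_left_le)
qed

end

section \<open>The Hahn--Banach theorem for complex Banach spaces\<close>

text \<open>Homogeneity is demanded only as an inequality, which is the form that infima satisfy
  directly; equality and \<open>q 0 = 0\<close> follow in \<open>sublinearD\<close>.\<close>

definition sublinear :: "('a::real_vector \<Rightarrow> real) \<Rightarrow> bool" where
  "sublinear q \<longleftrightarrow> (\<forall>x y. q (x + y) \<le> q x + q y) \<and> (\<forall>t>0. \<forall>x. q (t *\<^sub>R x) \<le> t * q x)"

lemma sublinearD:
  assumes "sublinear q"
  shows "q (x + y) \<le> q x + q y" "t > 0 \<Longrightarrow> q (t *\<^sub>R x) = t * q x" "q 0 = 0" "- q (- x) \<le> q x"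
proof -
  have hom: "q (t *\<^sub>R x) \<le> t * q x" if "t > 0" for t x using assms that by (simp add: sublinear_def)
  show add: "q (x + y) \<le> q x + q y" for x y using assms by (simp add: sublinear_def)
  show "q (t *\<^sub>R x) = t * q x" if "t > 0"
    using hom[of t x] hom[of "inverse t" "t *\<^sub>R x"] that by (simp add: field_simps)
  show 0: "q 0 = 0" using hom[of 2 0] hom[of "1/2" 0] by simp
  show "- q (- x) \<le> q x" using add[of x "- x"] 0 by simp
qed

text \<open>The infimum of \<open>q (y + t *\<^sub>R x) - t * q x\<close> over
  \<open>t \<ge> 0\<close> works: \<open>t = 0\<close> puts it below \<open>q\<close>, and
  \<open>t = 1\<close> gives the bound at \<open>- x\<close>. It shows minimal functionals to be odd
  and also produces functionals that attain the norm at a given point.\<close>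

lemma sublinear_descent:
  fixes q :: "'a::real_vector \<Rightarrow> real"
  assumes q: "sublinear q"
  obtains q' where "sublinear q'" "\<And>y. q' y \<le> q y" "q' (- x) \<le> - q x"
proof -
  define q' where "q' = (\<lambda>y. INF t\<in>{0..}. q (y + t *\<^sub>R x) - t * q x)"
  \<comment> \<open>An infimum of reals is meaningful only with a lower bound; subadditivity
    supplies \<open>- q (- y)\<close>.\<close>
  have bdd: "bdd_below ((\<lambda>t. q (y + t *\<^sub>R x) - t * q x) ` {0..})" for y
  proof (rule bdd_belowI2)
    fix t :: real assume "t \<in> {0..}"
    then have "t = 0 \<or> t > 0" by auto
    then have "q (t *\<^sub>R x) = t * q x" using sublinearD(2,3)[OF q] by auto
    moreover have "q (t *\<^sub>R x) \<le> q (y + t *\<^sub>R x) + q (- y)"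
      using sublinearD(1)[OF q, of "y + t *\<^sub>R x" "- y"] by simp
    ultimately show "- q (- y) \<le> q (y + t *\<^sub>R x) - t * q x" by simp
  qed
  have le: "q' y \<le> q (y + t *\<^sub>R x) - t * q x" if "t \<ge> 0" for t y
    unfolding q'_def using that by (intro cINF_lower bdd) auto
  have ge: "c \<le> q' y" if "\<And>t. t \<ge> 0 \<Longrightarrow> c \<le> q (y + t *\<^sub>R x) - t * q x" for c y
    unfolding q'_def using that by (intro cINF_greatest) auto
  show thesis
  proof
    show "q' y \<le> q y" for y using le[of 0 y] by simp
    show "q' (- x) \<le> - q x" using le[of 1 "- x"] sublinearD(3)[OF q] by simp
    show "sublinear q'"
      unfolding sublinear_def
    proof (intro conjI allI impI)
      fix y z
      have "q' (y + z) - (q (z + s *\<^sub>R x) - s * q x) \<le> q (y + t *\<^sub>R x) - t * q x"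
        if "s \<ge> 0" "t \<ge> 0" for s t
        using le[of "s + t" "y + z"] sublinearD(1)[OF q, of "y + t *\<^sub>R x" "z + s *\<^sub>R x"] that
        by (simp add: algebra_simps)
      then have "q' (y + z) - q' y \<le> q (z + s *\<^sub>R x) - s * q x" if "s \<ge> 0" for s
        using ge[of "q' (y + z) - (q (z + s *\<^sub>R x) - s * q x)" y] that by simp
      then show "q' (y + z) \<le> q' y + q' z" using ge[of "q' (y + z) - q' y" z] by simp
    next
      fix s :: real and y assume s: "s > 0"
      have "q' (s *\<^sub>R y) / s \<le> q (y + t *\<^sub>R x) - t * q x" if "t \<ge> 0" for t
        using le[of "s * t" "s *\<^sub>R y"] sublinearD(2)[OF q s, of "y + t *\<^sub>R x"] s that
        by (simp add: field_simps)
      then show "q' (s *\<^sub>R y) \<le> s * q' y" using ge[of "q' (s *\<^sub>R y) / s" y] s by (simp add: field_simps)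
    qed
  qed
qed

text \<open>The real Hahn--Banach theorem: a minimal sublinear functional below \<open>p\<close> is odd, because
  \<open>sublinear_descent\<close> cannot lower it, and an odd sublinear functional is linear.\<close>

lemma sublinear_dominates_linear:
  fixes p :: "'a::real_vector \<Rightarrow> real"
  assumes p: "sublinear p"
  obtains u where "linear u" "\<And>x. u x \<le> p x"
proof -
  let ?A = "{q. sublinear q \<and> (\<forall>x. q x \<le> p x)}"
  \<comment> \<open>The order is reversed, so a maximal element for Zorn's lemma is a minimal
    functional.\<close>
  let ?R = "\<lambda>a b :: 'a \<Rightarrow> real. \<forall>x. b x \<le> a x"
  have "\<exists>m\<in>?A. \<forall>a\<in>?A. ?R m a \<longrightarrow> a = m"
  proof (rule predicate_Zorn)
    show "partial_order_on ?A (relation_of ?R ?A)"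
      by (auto simp: partial_order_on_def preorder_on_def refl_on_def trans_def antisym_def
          relation_of_def intro: order.trans intro!: ext order.antisym)
  next
    fix C assume C: "C \<in> Chains (relation_of ?R ?A)"
    then have CA: "C \<subseteq> ?A" by (rule Chains_relation_of)
    show "\<exists>u\<in>?A. \<forall>a\<in>C. ?R a u"
    proof (cases "C = {}")
      case True
      then show ?thesis using p by auto
    next
      case False
      define u where "u = (\<lambda>x. INF q\<in>C. q x)"
      have bdd: "bdd_below ((\<lambda>q. q x) ` C)" for x
      proof (rule bdd_belowI2)
        fix q assume "q \<in> C"
        then have "sublinear q" "q (- x) \<le> p (- x)" using CA by auto
        then show "- p (- x) \<le> q x" using sublinearD(4)[of q x] by linarith
      qed
      have le: "u x \<le> q x" if "q \<in> C" for q x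
        unfolding u_def using that by (intro cINF_lower bdd)
      have ge: "c \<le> u x" if "\<And>q. q \<in> C \<Longrightarrow> c \<le> q x" for c x
        unfolding u_def using that False by (intro cINF_greatest)
      have "sublinear u"
        unfolding sublinear_def
      proof (intro conjI allI impI)
        fix x y
        have "u (x + y) - q2 y \<le> q1 x" if q: "q1 \<in> C" "q2 \<in> C" for q1 q2
        proof -
          \<comment> \<open>\<open>q1\<close> and \<open>q2\<close> are comparable in the chain; the
            smaller one serves both points.\<close>
          obtain q where "q \<in> C" "q x \<le> q1 x" "q y \<le> q2 y"
            using q C unfolding Chains_def relation_of_def by blast
          then show ?thesis using le[of q "x + y"] sublinearD(1)[of q x y] CA by fastforce
        qed
        then have "u (x + y) - u x \<le> q2 y" if "q2 \<in> C" for q2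
          using ge[of "u (x + y) - q2 y" x] that by fastforce
        then show "u (x + y) \<le> u x + u y" using ge[of "u (x + y) - u x" y] by fastforce
      next
        fix t :: real and x assume t: "t > 0"
        have "u (t *\<^sub>R x) / t \<le> q x" if "q \<in> C" for q
          using le[OF that, of "t *\<^sub>R x"] sublinearD(2)[of q t x] CA that t by (auto simp: field_simps)
        then show "u (t *\<^sub>R x) \<le> t * u x" using ge[of "u (t *\<^sub>R x) / t" x] t by (simp add: field_simps)
      qed
      moreover have "u x \<le> p x" for x using False le CA by (blast intro: order.trans)
      ultimately show ?thesis using le by blast
    qed
  qed
  then obtain u where u: "sublinear u" "\<And>x. u x \<le> p x"
    and min: "\<And>q. sublinear q \<Longrightarrow> (\<And>x. q x \<le> u x) \<Longrightarrow> q = u"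
    by (auto intro: order.trans) (metis order.trans)
  have odd: "u (- x) = - u x" for x
  proof -
    obtain q' where "sublinear q'" "\<And>y. q' y \<le> u y" "q' (- x) \<le> - u x"
      using sublinear_descent[OF u(1)] by blast
    then show ?thesis using min[of q'] sublinearD(4)[OF u(1), of x] by auto
  qed
  have "linear u"
  proof (rule linearI)
    fix x y
    \<comment> \<open>Subadditivity for \<open>x = (x + y) + (- y)\<close> together with oddness
      gives the reverse inequality.\<close>
    show "u (x + y) = u x + u y"
      using sublinearD(1)[OF u(1), of x y] sublinearD(1)[OF u(1), of "x + y" "- y"] odd[of y] by simp
  next
    fix t :: real and x
    consider "t > 0" | "t = 0" | "- t > 0" by (cases t "0::real" rule: linorder_cases) auto
    then show "u (t *\<^sub>R x) = t *\<^sub>R u x"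
    proof cases
      case 3
      then show ?thesis using sublinearD(2)[OF u(1) 3, of x] odd[of "t *\<^sub>R x"] by simp
    qed (simp_all add: sublinearD(2,3)[OF u(1)])
  qed
  then show thesis using u(2) that by blast
qed

section \<open>Norming functionals over the complex scalars\<close>

lemma clinear_iff:
  "clinear f \<longleftrightarrow> (\<forall>x y. f (x + y) = f x + f y) \<and> (\<forall>c x. f (c *\<^sub>C x) = c *\<^sub>C f x)"
  by (simp add: Vector_Spaces.linear_iff vector_space_scaleC)

lemma clinear_complex_iff:
  "clinear (l :: 'a::complex_banach \<Rightarrow> complex) \<longleftrightarrow>
     (\<forall>x y. l (x + y) = l x + l y) \<and> (\<forall>c x. l (c *\<^sub>C x) = c * l x)"
  unfolding clinear_iff by (simp add: scaleC_complex_def)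

lemma scaleC_Re_Im: "c *\<^sub>C x = Re c *\<^sub>R x + Im c *\<^sub>R (\<i> *\<^sub>C x)"
proof -
  have "c = of_real (Re c) + of_real (Im c) * \<i>" by (simp add: complex_eq_iff)
  then show ?thesis by (metis scaleC_add_left scaleC_scaleC scaleC_of_real)
qed

text \<open>Lowering the norm at \<open>- x0\<close> by \<open>sublinear_descent\<close> forces
  every dominated linear \<open>u\<close> to satisfy \<open>u x0 = norm x0\<close>, so no extension
  from a subspace is required. The complex functional is \<open>u(z) - i u(iz)\<close>.\<close>

lemma complex_hahn_banach:
  fixes x0 :: "'a::complex_banach"
  obtains l :: "'a \<Rightarrow> complex" where "clinear l" "bounded_linear l"
    "\<And>z. cmod (l z) \<le> norm z" "l x0 = of_real (norm x0)"
proof -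
  have "sublinear (norm :: 'a \<Rightarrow> real)" by (simp add: sublinear_def norm_triangle_ineq)
  then obtain p where p: "sublinear p" "\<And>y. p y \<le> norm y" "p (- x0) \<le> - norm x0"
    using sublinear_descent[of norm x0] by blast
  obtain u where u: "linear u" "\<And>x. u x \<le> p x" using sublinear_dominates_linear[OF p(1)] by blast
  have un: "u x \<le> norm x" for x using u(2) p(2) by (rule order.trans)
  have ux0: "u x0 = norm x0"
    using un[of x0] u(2)[of "- x0"] p(3) linear_neg[OF u(1), of x0] by simp
  define l where "l = (\<lambda>z. Complex (u z) (- u (\<i> *\<^sub>C z)))"
  have ii: "\<i> *\<^sub>C \<i> *\<^sub>C z = - z" for z :: 'a
    using scaleC_of_real[of "-1" z] by (simp add: scaleC_scaleC)
  have add: "l (x + y) = l x + l y" for x y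
    by (simp add: l_def scaleC_add_right linear_add[OF u(1)] complex_eq_iff)
  have uc: "u (c *\<^sub>C z) = Re c * u z + Im c * u (\<i> *\<^sub>C z)" for c z
    by (simp add: scaleC_Re_Im[of c] linear_add[OF u(1)] linear_scale[OF u(1)])
  have scale: "l (c *\<^sub>C z) = c * l z" for c z
    using uc[of "\<i> * c" z] uc[of c z] by (simp add: l_def complex_eq_iff scaleC_scaleC)
  have bound: "cmod (l z) \<le> norm z" for z
  proof -
    \<comment> \<open>Rotating \<open>l z\<close> to the nonnegative real axis turns its modulus
      into a value of \<open>u\<close>.\<close>
    define c where "c = cnj (sgn (l z))"
    have "c * l z = of_real (cmod (l z))"
      by (cases "l z = 0") (auto simp: c_def sgn_eq power2_eq_square complex_norm_square[symmetric] mult.commute[of "cnj _"])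
    then have "cmod (l z) = u (c *\<^sub>C z)" using scale[of c z] by (simp add: l_def complex_eq_iff)
    also have "\<dots> \<le> norm (c *\<^sub>C z)" by (rule un)
    also have "\<dots> \<le> norm z" by (simp add: norm_scaleC c_def norm_sgn)
    finally show ?thesis .
  qed
  show thesis
  proof
    show cl: "clinear l" using add scale by (simp add: clinear_complex_iff)
    show "bounded_linear l"
    proof (rule bounded_linear_intro[where K = 1])
      show "l (r *\<^sub>R x) = r *\<^sub>R l x" for r x
        using scale[of "of_real r" x] by (simp add: scaleC_of_real scaleR_conv_of_real)
    qed (use add bound in auto)
    show "cmod (l z) \<le> norm z" for z by (rule bound)
    \<comment> \<open>The real part of \<open>l x0\<close> is already \<open>norm x0\<close>, so the
      norm bound leaves no room for an imaginary part.\<close>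
    have "(norm x0)\<^sup>2 + (Im (l x0))\<^sup>2 \<le> (norm x0)\<^sup>2"
      using power_mono[OF bound[of x0], of 2] by (simp add: cmod_power2 l_def ux0)
    then show "l x0 = of_real (norm x0)" by (simp add: complex_eq_iff l_def ux0)
  qed
qed

section \<open>Slices and homogeneous expansions\<close>

text \<open>Multilinearity releases one factor \<open>c\<close> per coordinate; the induction scales
  only the first \<open>n\<close> entries.\<close>

lemma homogeneous_polynomial_scaleC:
  assumes "homogeneous_polynomial j P"
  shows "P (c *\<^sub>C x) = (c ^ j) *\<^sub>C P x"
proof -
  obtain u where u: "continuous_multilinear j u" and P: "\<And>x. P x = u (\<lambda>_. x)"
    using assms unfolding homogeneous_polynomial_def by blast
  have "u (\<lambda>i. if i < n then c *\<^sub>C x else x) = (c ^ n) *\<^sub>C u (\<lambda>_. x)" if "n \<le> j" for n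
    using that
  proof (induction n)
    case 0
    show ?case using scaleC_of_real[of 1 "u (\<lambda>_. x)"] by simp
  next
    case (Suc n)
    let ?w = "\<lambda>i. if i < n then c *\<^sub>C x else x"
    have eqs: "(\<lambda>i. if i < Suc n then c *\<^sub>C x else x) = ?w(n := c *\<^sub>C x)" "?w(n := x) = ?w"
      by (auto simp: fun_eq_iff)
    have "clinear (\<lambda>y. u (?w(n := y)))"
      using u Suc.prems unfolding continuous_multilinear_def by auto
    then have "u (?w(n := c *\<^sub>C x)) = c *\<^sub>C u (?w(n := x))"
      unfolding clinear_iff by blast
    then show ?case using Suc.IH Suc.prems unfolding eqs by (simp add: scaleC_scaleC)
  qed
  from this[of j] have "u (\<lambda>i. if i < j then c *\<^sub>C x else x) = (c ^ j) *\<^sub>C P x"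
    by (simp add: P)
  \<comment> \<open>Entries of index at least \<open>j\<close> do not influence \<open>u\<close>, so
    the tail may be scaled as well.\<close>
  moreover have "u (\<lambda>i. if i < j then c *\<^sub>C x else x) = u (\<lambda>_. c *\<^sub>C x)"
  proof -
    have "\<forall>v w. (\<forall>i<j. v i = w i) \<longrightarrow> u v = u w"
      using u unfolding continuous_multilinear_def by blast
    then have *: "\<forall>i<j. v i = w i \<Longrightarrow> u v = u w" for v w by blast
    show ?thesis by (rule *) simp
  qed
  ultimately show ?thesis by (simp add: P)
qed

lemma homogeneous_expansion_scaleC:
  "homogeneous_expansion f P \<Longrightarrow> P j (c *\<^sub>C x) = (c ^ j) *\<^sub>C P j x"
  unfolding homogeneous_expansion_def by (rule homogeneous_polynomial_scaleC) blast

text \<open>Places every point on a complex line through a unit vector, where one-variable theory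
  applies; at 0 any unit vector will do.\<close>

lemma unit_direction:
  fixes z :: "'a::complex_banach"
  assumes "(UNIV :: 'a set) \<noteq> {0}"
  obtains x where "norm x = 1" "z = of_real (norm z) *\<^sub>C x"
proof (cases "z = 0")
  case True
  obtain y :: 'a where "y \<noteq> 0" using assms by auto
  then show thesis using that[of "y /\<^sub>R norm y"] True scaleC_of_real[of 0 "y /\<^sub>R norm y"] by simp
next
  case False
  then show thesis using that[of "z /\<^sub>R norm z"] by (simp add: scaleC_of_real)
qed

text \<open>The functional \<open>l\<close> allows values in any space: it is the identity for a
  scalar \<open>f\<close> and a norming functional for a Schwarz map.\<close>

lemma bounded_power_series_slice:
  fixes f :: "'a::complex_banach \<Rightarrow> 'b::complex_banach"
  assumes f: "homogeneous_expansion f P" "f ` ball 0 1 \<subseteq> ball 0 1"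
    and l: "clinear l" "bounded_linear l" "\<And>y. cmod (l y) \<le> norm y" and x: "norm x = 1"
  shows "bounded_power_series (\<lambda>j. l (P j x)) (\<lambda>\<zeta>. l (f (\<zeta> *\<^sub>C x)))"
proof
  fix \<zeta> :: complex assume z: "cmod \<zeta> < 1"
  then have b: "\<zeta> *\<^sub>C x \<in> ball 0 1" by (simp add: norm_scaleC x)
  have "l (P j (\<zeta> *\<^sub>C x)) = l (P j x) * \<zeta> ^ j" for j
    unfolding homogeneous_expansion_scaleC[OF f(1)]
    using l(1) by (simp add: clinear_complex_iff mult.commute)
  moreover have "(\<lambda>j. l (P j (\<zeta> *\<^sub>C x))) sums l (f (\<zeta> *\<^sub>C x))"
    using f(1) b by (intro bounded_linear.sums[OF l(2)]) (auto simp: homogeneous_expansion_def)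
  ultimately show "(\<lambda>j. l (P j x) * \<zeta> ^ j) sums l (f (\<zeta> *\<^sub>C x))" by simp
  have "f (\<zeta> *\<^sub>C x) \<in> ball 0 1" using f(2) b by blast
  then show "cmod (l (f (\<zeta> *\<^sub>C x))) \<le> 1" using l(3)[of "f (\<zeta> *\<^sub>C x)"] by simp
qed

lemma clinear_complex_id: "clinear (\<lambda>z::complex. z)"
  by (simp add: clinear_iff)

text \<open>A functional norming \<open>\<mu> z\<close> turns the slice through \<open>z\<close>
  into a scalar series with vanishing first \<open>n\<close> coefficients, to which
  \<open>schwarz_order\<close> applies.\<close>

lemma schwarz_map_order_bound:
  fixes \<mu> :: "'a::complex_banach \<Rightarrow> 'a"
  assumes \<mu>: "schwarz_map \<mu>" "zero_of_order n \<mu>" and z: "norm z < 1"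
    and X: "(UNIV :: 'a set) \<noteq> {0}"
  shows "norm (\<mu> z) \<le> norm z ^ n"
proof -
  obtain Q where Q: "homogeneous_expansion \<mu> Q" "\<And>j x. j < n \<Longrightarrow> Q j x = 0"
    using \<mu>(2) unfolding zero_of_order_def by blast
  obtain l :: "'a \<Rightarrow> complex" where l: "clinear l" "bounded_linear l"
      "\<And>y. cmod (l y) \<le> norm y" "l (\<mu> z) = of_real (norm (\<mu> z))"
    using complex_hahn_banach[of "\<mu> z"] by blast
  obtain x where x: "norm x = 1" "z = of_real (norm z) *\<^sub>C x" by (rule unit_direction[OF X])
  interpret bounded_power_series "\<lambda>j. l (Q j x)" "\<lambda>\<zeta>. l (\<mu> (\<zeta> *\<^sub>C x))"
    using \<mu>(1) unfolding schwarz_map_def by (intro bounded_power_series_slice Q(1) l(1-3) x(1)) auto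
  have "cmod (l (\<mu> (of_real (norm z) *\<^sub>C x))) \<le> cmod (of_real (norm z)) ^ n"
    using z linear_0[OF bounded_linear.linear[OF l(2)]] Q(2) by (intro schwarz_order) auto
  then show ?thesis using l(4) x(2) by simp
qed

section \<open>The Bohr functional\<close>

definition bohr_majorant :: "nat \<Rightarrow> nat \<Rightarrow> real \<Rightarrow> real \<Rightarrow> real \<Rightarrow> real \<Rightarrow> real" where
  "bohr_majorant k m p lam a r =
     ((a + r ^ m) / (1 + a * r ^ m)) powr p + lam * ((1 - a\<^sup>2) * r ^ k / (1 - r ^ k))"

text \<open>The factors in front of the last one are positive, so a zero of
  \<open>\<Psi>\<^sub>4\<close> is a point where the majorant equals 1.\<close>

lemma \<Psi>\<^sub>4_eq_bohr_majorant:
  assumes "k \<ge> 1" "0 \<le> a" "0 \<le> r" "r < 1"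
  shows "\<Psi>\<^sub>4 k m p lam a r =
    (1 + a * r ^ m) powr p * (1 - r ^ k) * (1 - bohr_majorant k m p lam a r)"
proof -
  have "r ^ k < 1" using assms by (simp add: power_less_one_iff)
  moreover have "1 + a * r ^ m > 0" using assms by (simp add: add_pos_nonneg)
  moreover have "((a + r ^ m) / (1 + a * r ^ m)) powr p = (a + r ^ m) powr p / (1 + a * r ^ m) powr p"
    by (rule powr_divide)
  ultimately show ?thesis
    by (simp add: \<Psi>\<^sub>4_def bohr_majorant_def field_simps)
qed

lemma moebius_growth_mono:
  fixes a s t :: real
  assumes "0 \<le> a" "a < 1" "0 \<le> s" "s \<le> t"
  shows "(a + s) / (1 + a * s) \<le> (a + t) / (1 + a * t)"
proof -
  have "(1 - a\<^sup>2) * s \<le> (1 - a\<^sup>2) * t" using assms by (intro mult_left_mono) (auto simp: power_le_one)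
  moreover have "1 + a * s > 0" "1 + a * t > 0" using assms by (simp_all add: add_pos_nonneg)
  ultimately show ?thesis by (simp add: field_simps power2_eq_square)
qed

text \<open>Strictness comes from the second summand, whose factor
  \<open>lam * (1 - a\<^sup>2)\<close> is positive.\<close>

lemma bohr_majorant_strict_mono:
  assumes "k \<ge> 1" "p > 0" "lam > 0" "0 \<le> a" "a < 1" "0 \<le> r" "r < s" "s < 1"
  shows "bohr_majorant k m p lam a r < bohr_majorant k m p lam a s"
proof -
  have "r ^ m \<le> s ^ m" using assms by (intro power_mono) auto
  then have 1: "((a + r ^ m) / (1 + a * r ^ m)) powr p \<le> ((a + s ^ m) / (1 + a * s ^ m)) powr p"
    using assms by (intro powr_mono2 moebius_growth_mono) auto
  have "r ^ k < s ^ k" using assms by (intro power_strict_mono) auto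
  moreover have "s ^ k < 1" using assms by (simp add: power_less_one_iff)
  ultimately have "r ^ k / (1 - r ^ k) < s ^ k / (1 - s ^ k)" by (simp add: field_simps)
  moreover have "lam * (1 - a\<^sup>2) > 0" using assms by (simp add: power_less_one_iff)
  ultimately have "lam * (1 - a\<^sup>2) * (r ^ k / (1 - r ^ k)) < lam * (1 - a\<^sup>2) * (s ^ k / (1 - s ^ k))"
    by (rule mult_strict_left_mono)
  then show ?thesis using 1 by (simp add: bohr_majorant_def mult_ac)
qed

text \<open>Two slices of \<open>f\<close> are used: one through \<open>\<mu> k z\<close> for the
  series, one through \<open>\<mu> m z\<close> for the Schwarz-Pick term.\<close>

lemma bohr_functional_le_majorant:
  fixes f :: "'a::complex_banach \<Rightarrow> complex"
  assumes X: "(UNIV :: 'a set) \<noteq> {0}"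
    and k: "k \<ge> 1" and m: "m \<ge> 1" and p: "p > 0" and lam: "lam > 0" and a: "0 \<le> a" "a < 1"
    and adm: "admissible_data a f P \<mu>" and z: "norm z < 1"
  shows "bohr_series_converge k P \<mu> z"
    and "bohr_functional k m p lam a f P \<mu> z \<le> bohr_majorant k m p lam a (norm z)"
proof -
  let ?r = "norm z" and ?C = "1 / (1 + a) + norm z ^ k / (1 - norm z ^ k)"
  have f: "homogeneous_expansion f P" "f ` ball 0 1 \<subseteq> ball 0 1" "cmod (f 0) = a"
    and \<mu>: "\<And>n. n \<ge> 1 \<Longrightarrow> norm (\<mu> n z) \<le> ?r ^ n"
    using adm z X unfolding admissible_data_def by (auto intro: schwarz_map_order_bound)
  have slice: "bounded_power_series (\<lambda>j. P j x) (\<lambda>\<zeta>. f (\<zeta> *\<^sub>C x))" if "norm x = 1" for x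
    using bounded_power_series_slice[OF f(1,2) clinear_complex_id bounded_linear_ident _ that] by simp
  have zero: "0 *\<^sub>C x = 0" for x :: 'a using scaleC_of_real[of 0 x] by simp
  have rk: "0 \<le> ?r ^ k" "?r ^ k < 1" and rm: "?r ^ m < 1"
    using z k m by (auto simp: power_less_one_iff)
  obtain x where x: "norm x = 1" "\<mu> k z = of_real (norm (\<mu> k z)) *\<^sub>C x"
    by (rule unit_direction[OF X])
  \<comment> \<open>Powers of \<open>norm z ^ k\<close> rather than of
    \<open>norm (\<mu> k z)\<close>, so that \<open>\<rho>\<close> in \<open>bohr_inequality\<close>
    matches the constant \<open>?C\<close>.\<close>
  define b where "b = (\<lambda>j. cmod (P (Suc j) x) * (?r ^ k) ^ Suc j)"
  interpret bx: bounded_power_series "\<lambda>j. P j x" "\<lambda>\<zeta>. f (\<zeta> *\<^sub>C x)" by (rule slice[OF x(1)])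
  have b0: "cmod (P 0 x) = a"
    using sums_unique2[OF bx.sums[of 0] powser_sums_zero] f(3) by (simp add: zero)
  have le: "cmod (P (Suc j) (\<mu> k z)) \<le> b j" for j
  proof -
    have "P (Suc j) (\<mu> k z) = of_real (norm (\<mu> k z)) ^ Suc j * P (Suc j) x"
      by (subst x(2), unfold homogeneous_expansion_scaleC[OF f(1)]) (simp add: scaleC_complex_def)
    then show ?thesis
      using power_mono[OF \<mu>[OF k], of "Suc j"]
      by (simp add: b_def norm_mult norm_power mult.commute[of "cmod (P _ _)"] mult_right_mono del: power_Suc)
  qed
  have le2: "(cmod (P (Suc j) (\<mu> k z)))\<^sup>2 \<le> (b j)\<^sup>2" for j
    by (intro power_mono le) auto
  note sb = bx.bohr_summable[OF rk, folded b_def]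
  have s1: "summable (\<lambda>j. cmod (P (Suc j) (\<mu> k z)))"
    by (rule summable_comparison_test'[OF sb(1)[unfolded b_def], of 0]) (use le in \<open>simp add: b_def\<close>)
  have s2: "summable (\<lambda>j. (cmod (P (Suc j) (\<mu> k z)))\<^sup>2)"
    by (rule summable_comparison_test'[OF sb(2)[unfolded b_def], of 0]) (use le2 in \<open>simp add: b_def\<close>)
  show "bohr_series_converge k P \<mu> z" using s1 s2 by (simp add: bohr_series_converge_def)
  have "(\<Sum>j. cmod (P (Suc j) (\<mu> k z))) \<le> (\<Sum>j. b j)"
    by (rule suminf_le[OF le s1]) (use sb in \<open>simp add: b_def\<close>)
  moreover have "(\<Sum>j. (cmod (P (Suc j) (\<mu> k z)))\<^sup>2) \<le> (\<Sum>j. (b j)\<^sup>2)"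
    by (rule suminf_le[OF le2 s2]) (use sb in \<open>simp add: b_def\<close>)
  moreover have "?C \<ge> 0" using a rk by simp
  ultimately have "(\<Sum>j. cmod (P (Suc j) (\<mu> k z))) + ?C * (\<Sum>j. (cmod (P (Suc j) (\<mu> k z)))\<^sup>2)
      \<le> (\<Sum>j. b j) + ?C * (\<Sum>j. (b j)\<^sup>2)"
    by (intro add_mono mult_left_mono)
  also have "\<dots> \<le> (1 - a\<^sup>2) * ?r ^ k / (1 - ?r ^ k)"
    using bx.bohr_inequality[OF rk] unfolding b0 b_def .
  finally have tail: "(\<Sum>j. cmod (P (Suc j) (\<mu> k z))) + ?C * (\<Sum>j. (cmod (P (Suc j) (\<mu> k z)))\<^sup>2)
      \<le> (1 - a\<^sup>2) * ?r ^ k / (1 - ?r ^ k)" .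
  obtain y where y: "norm y = 1" "\<mu> m z = of_real (norm (\<mu> m z)) *\<^sub>C y"
    by (rule unit_direction[OF X])
  interpret bz: bounded_power_series "\<lambda>j. P j y" "\<lambda>\<zeta>. f (\<zeta> *\<^sub>C y)" by (rule slice[OF y(1)])
  \<comment> \<open>Schwarz-Pick asks for the strict bound, while the locale records only the weak
    one.\<close>
  have "cmod (f (\<zeta> *\<^sub>C y)) < 1" if "cmod \<zeta> < 1" for \<zeta>
  proof -
    have "f (\<zeta> *\<^sub>C y) \<in> ball 0 1" using f(2) that y(1) by (auto simp: norm_scaleC image_subset_iff)
    then show ?thesis by simp
  qed
  then have "cmod (f (of_real (norm (\<mu> m z)) *\<^sub>C y))
      \<le> (cmod (f (0 *\<^sub>C y)) + cmod (of_real (norm (\<mu> m z)))) / (1 + cmod (f (0 *\<^sub>C y)) * cmod (of_real (norm (\<mu> m z))))"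
    using \<mu>[OF m] rm by (intro schwarz_pick_growth bz.holomorphic) auto
  then have "cmod (f (\<mu> m z)) \<le> (a + norm (\<mu> m z)) / (1 + a * norm (\<mu> m z))"
    using f(3) y(2) by (simp add: zero)
  also have "\<dots> \<le> (a + ?r ^ m) / (1 + a * ?r ^ m)"
    using a \<mu>[OF m] by (intro moebius_growth_mono) auto
  finally have "cmod (f (\<mu> m z)) powr p \<le> ((a + ?r ^ m) / (1 + a * ?r ^ m)) powr p"
    using p by (intro powr_mono2) auto
  then show "bohr_functional k m p lam a f P \<mu> z \<le> bohr_majorant k m p lam a ?r"
    using tail lam unfolding bohr_functional_def bohr_majorant_def
    by (intro add_mono mult_left_mono) auto
qed

section \<open>The extremal mappings\<close>

lemma bounded_bilinear_scaleC: "bounded_bilinear (scaleC :: complex \<Rightarrow> 'a::complex_banach \<Rightarrow> 'a)"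
proof
  show "\<exists>K. \<forall>c (x::'a). norm (c *\<^sub>C x) \<le> norm c * norm x * K"
    by (intro exI[of _ 1]) (simp add: norm_scaleC)
  show "(r *\<^sub>R c) *\<^sub>C x = r *\<^sub>R (c *\<^sub>C x)" "c *\<^sub>C (r *\<^sub>R x) = r *\<^sub>R (c *\<^sub>C x)" for r c and x :: 'a
    by (simp_all add: scaleC_scaleC scaleR_conv_of_real mult.commute flip: scaleC_of_real)
qed (simp_all add: scaleC_add_left scaleC_add_right)

lemmas scaleC_minus_right = bounded_bilinear.minus_right[OF bounded_bilinear_scaleC]
  and scaleC_diff_right = bounded_bilinear.diff_right[OF bounded_bilinear_scaleC]

locale norm_one_functional =
  fixes l :: "'a::complex_banach \<Rightarrow> complex" and x0 :: 'a
  assumes clinear: "clinear l" and bounded_linear: "bounded_linear l"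
    and norm_le: "cmod (l z) \<le> norm z" and norm_x0: "norm x0 = 1" and l_x0: "l x0 = 1"
begin

lemma add: "l (x + y) = l x + l y" and scale: "l (c *\<^sub>C x) = c * l x"
  using clinear by (auto simp: clinear_complex_iff)

lemma continuous_on_product:
  "continuous_on UNIV (\<lambda>v. \<Prod>i<n. l (v i))"
  by (intro continuous_on_prod bounded_linear.continuous_on[OF bounded_linear] continuous_on_product_coordinates)

lemma product_upd:
  fixes i n :: nat
  assumes "i < n"
  shows "(\<Prod>i'<n. l ((w(i := x)) i')) = l x * (\<Prod>i'\<in>{..<n} - {i}. l (w i'))"
  using assms by (subst prod.remove[of _ i]) (auto intro: prod.cong)

lemma homogeneous_polynomial_power: "homogeneous_polynomial n (\<lambda>z. c * l z ^ n)"
  unfolding homogeneous_polynomial_def continuous_multilinear_def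
proof (intro exI[of _ "\<lambda>v. c * (\<Prod>i<n. l (v i))"] conjI allI impI)
  show "continuous_on UNIV (\<lambda>v. c * (\<Prod>i<n. l (v i)))"
    by (intro continuous_intros continuous_on_product)
  show "clinear (\<lambda>x. c * (\<Prod>i'<n. l ((w(i := x)) i')))" if "i < n" for i w
    unfolding product_upd[OF that] by (simp add: clinear_complex_iff add scale algebra_simps)
qed auto

lemma homogeneous_polynomial_power_scaleC:
  "homogeneous_polynomial (Suc n) (\<lambda>z. - ((l z ^ n) *\<^sub>C z))"
  unfolding homogeneous_polynomial_def continuous_multilinear_def
proof (intro exI[of _ "\<lambda>v. - ((\<Prod>i<n. l (v i)) *\<^sub>C v n)"] conjI allI impI)
  show "continuous_on UNIV (\<lambda>v. - ((\<Prod>i<n. l (v i)) *\<^sub>C v n))"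
    by (intro continuous_on_minus bounded_bilinear.continuous_on[OF bounded_bilinear_scaleC]
        continuous_on_product continuous_on_product_coordinates)
  show "clinear (\<lambda>x. - ((\<Prod>i'<n. l ((w(i := x)) i')) *\<^sub>C (w(i := x)) n))" if "i < Suc n" for i w
  proof (cases "i = n")
    case True
    then show ?thesis
      by (simp add: clinear_iff scaleC_add_right scaleC_scaleC scaleC_minus_right mult.commute)
  next
    case False
    then have "i < n" using that by simp
    show ?thesis unfolding product_upd[OF \<open>i < n\<close>]
      using False by (simp add: clinear_iff add scale scaleC_add_left scaleC_scaleC scaleC_minus_right algebra_simps)
  qed
qed auto

lemma homogeneous_polynomial_0: "homogeneous_polynomial n (\<lambda>z :: 'a. 0 :: 'a)"
  unfolding homogeneous_polynomial_def continuous_multilinear_def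
  by (intro exI[of _ "\<lambda>_. 0"])
    (simp add: clinear_iff bounded_bilinear.zero_right[OF bounded_bilinear_scaleC])

text \<open>The sign gives \<open>l (\<mu> n z) = - l z ^ n\<close> for \<open>n \<ge> 1\<close>,
  which puts \<open>f a (\<mu> n z)\<close> on the side where its modulus grows.\<close>

definition \<mu> :: "nat \<Rightarrow> 'a \<Rightarrow> 'a" where
  "\<mu> n z = - ((l z ^ (n - 1)) *\<^sub>C z)"

lemma schwarz_map_\<mu>: "schwarz_map (\<mu> n)"
  unfolding schwarz_map_def
proof (intro conjI)
  show "\<mu> n 0 = 0"
    by (simp add: \<mu>_def bounded_bilinear.zero_right[OF bounded_bilinear_scaleC])
  show "\<mu> n ` ball 0 1 \<subseteq> ball 0 1"
  proof clarsimp
    fix z :: 'a assume z: "norm z < 1"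
    then have "cmod (l z) ^ (n - 1) \<le> 1" using norm_le[of z] by (intro power_le_one) auto
    then have "norm (\<mu> n z) \<le> norm z"
      by (simp add: \<mu>_def norm_scaleC norm_power mult_left_le_one_le)
    then show "norm (\<mu> n z) < 1" using z by simp
  qed
  show "holomorphic_map_on (\<mu> n) (ball 0 1)"
    unfolding holomorphic_map_on_def
  proof (intro ballI exI conjI)
    fix z :: 'a
    \<comment> \<open>For \<open>n \<le> 1\<close> the factor \<open>of_nat (n - 1)\<close> is 0 and
      removes the truncated exponent \<open>n - 1 - 1\<close>.\<close>
    let ?D = "\<lambda>h. - ((l z ^ (n - 1)) *\<^sub>C h + (of_nat (n - 1) * l h * l z ^ (n - 1 - 1)) *\<^sub>C z)"
    show "(\<mu> n has_derivative ?D) (at z)"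
      unfolding \<mu>_def
      by (intro has_derivative_minus bounded_bilinear.FDERIV[OF bounded_bilinear_scaleC]
          has_derivative_power bounded_linear_imp_has_derivative[OF bounded_linear] has_derivative_ident)
    show "clinear ?D"
      by (simp add: clinear_iff add scale scaleC_add_left scaleC_add_right scaleC_scaleC
          scaleC_minus_right scaleC_diff_right distrib_left distrib_right mult_ac)
  qed
qed

text \<open>\<open>\<mu> n\<close> is itself homogeneous of degree \<open>n\<close>, so its
  expansion has a single term; that term is nonzero at \<open>x0\<close>.\<close>

lemma zero_of_order_\<mu>:
  assumes "n \<ge> 1"
  shows "zero_of_order n (\<mu> n)"
  unfolding zero_of_order_def
proof (intro exI[of _ "\<lambda>j z. if j = n then \<mu> n z else 0"] conjI allI impI)
  obtain n' where n: "n = Suc n'" using assms by (cases n) auto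
  have "homogeneous_polynomial n (\<mu> n)"
    using homogeneous_polynomial_power_scaleC[of n'] unfolding n \<mu>_def by simp
  then have "homogeneous_polynomial j (\<lambda>z. if j = n then \<mu> n z else 0)" for j
    by (cases "j = n") (simp_all add: homogeneous_polynomial_0)
  then show "homogeneous_expansion (\<mu> n) (\<lambda>j z. if j = n then \<mu> n z else 0)"
    unfolding homogeneous_expansion_def using sums_single[of n "\<lambda>_. \<mu> n _"] by auto
  show "\<exists>x. (if n = n then \<mu> n x else 0) \<noteq> 0"
  proof
    have "norm (\<mu> n x0) = 1" by (simp add: \<mu>_def norm_scaleC l_x0 norm_x0)
    then show "(if n = n then \<mu> n x0 else 0) \<noteq> 0" by auto
  qed
qed auto

definition f :: "real \<Rightarrow> 'a \<Rightarrow> complex" where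
  "f a z = - Moebius_function 0 (of_real a) (l z)"

text \<open>Taylor terms of \<open>(a - \<zeta>) / (1 - a * \<zeta>)\<close> at
  \<open>\<zeta> = l z\<close>. For \<open>a = 0\<close> the convention \<open>0 ^ 0 = 1\<close>
  leaves only \<open>- l z\<close>.\<close>

definition P :: "real \<Rightarrow> nat \<Rightarrow> 'a \<Rightarrow> complex" where
  "P a j z = (case j of 0 \<Rightarrow> of_real a | Suc i \<Rightarrow> of_real (- (1 - a\<^sup>2) * a ^ i) * l z ^ j)"

lemma homogeneous_expansion_f:
  assumes a: "0 \<le> a" "a < 1"
  shows "homogeneous_expansion (f a) (P a)"
  unfolding homogeneous_expansion_def
proof (intro conjI allI ballI)
  show "homogeneous_polynomial j (P a j)" for j
    unfolding P_def by (cases j) (use homogeneous_polynomial_power[of j] homogeneous_polynomial_power[of 0] in simp_all)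
  fix z :: 'a assume z: "z \<in> ball 0 1"
  let ?\<zeta> = "l z" and ?a = "complex_of_real a"
  have "cmod (?a * ?\<zeta>) < 1"
  proof -
    have "cmod (?a * ?\<zeta>) \<le> cmod ?\<zeta>" using a by (simp add: norm_mult mult_left_le_one_le)
    then show ?thesis using norm_le[of z] z by simp
  qed
  then have s: "(\<lambda>i. (?a * ?\<zeta>) ^ i) sums (1 / (1 - ?a * ?\<zeta>))" and ne: "?a * ?\<zeta> \<noteq> 1"
    by (auto intro: geometric_sums)
  have "(\<lambda>i. of_real (- (1 - a\<^sup>2)) * ?\<zeta> * (?a * ?\<zeta>) ^ i) sums (of_real (- (1 - a\<^sup>2)) * ?\<zeta> * (1 / (1 - ?a * ?\<zeta>)))"
    by (rule sums_mult[OF s])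
  also have "(\<lambda>i. of_real (- (1 - a\<^sup>2)) * ?\<zeta> * (?a * ?\<zeta>) ^ i) = (\<lambda>i. P a (Suc i) z)"
    by (simp add: P_def fun_eq_iff power_mult_distrib mult_ac)
  also have "of_real (- (1 - a\<^sup>2)) * ?\<zeta> * (1 / (1 - ?a * ?\<zeta>)) = f a z - P a 0 z"
    using ne by (simp add: f_def P_def Moebius_function_simple field_simps power2_eq_square)
  finally have "(\<lambda>j. P a j z) sums (f a z - P a 0 z + P a 0 z)" by (rule sums_Suc)
  then show "(\<lambda>j. P a j z) sums f a z" by simp
qed

lemma admissible_data:
  assumes a: "0 \<le> a" "a < 1"
  shows "admissible_data a (f a) (P a) \<mu>"
  unfolding admissible_data_def
proof (intro conjI allI impI)
  have l1: "cmod (l z) < 1" if "z \<in> ball 0 1" for z using norm_le[of z] that by simp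
  have a1: "cmod (of_real a) < 1" using a by simp
  show "holomorphic_map_on (f a) (ball 0 1)"
    unfolding holomorphic_map_on_def
  proof
    fix z :: 'a assume z: "z \<in> ball 0 1"
    let ?\<phi> = "\<lambda>\<zeta>. - Moebius_function 0 (of_real a) \<zeta>"
    have "?\<phi> holomorphic_on ball 0 1"
      by (intro holomorphic_intros Moebius_function_holomorphic a1)
    then obtain d where "(?\<phi> has_field_derivative d) (at (l z))"
      using l1[OF z] by (meson field_differentiable_def holomorphic_on_imp_differentiable_at mem_ball_0 open_ball)
    then have "(?\<phi> has_derivative (\<lambda>h. d * h)) (at (l z))"
      by (simp add: has_field_derivative_def)
    from has_derivative_compose[OF bounded_linear_imp_has_derivative[OF bounded_linear] this]
    have "(f a has_derivative (\<lambda>h. d * l h)) (at z)" by (simp add: f_def[abs_def])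
    moreover have "clinear (\<lambda>h. d * l h)"
      by (simp add: clinear_complex_iff add scale algebra_simps)
    ultimately show "\<exists>D. clinear D \<and> (f a has_derivative D) (at z)" by blast
  qed
  show "f a ` ball 0 1 \<subseteq> ball 0 1"
    using Moebius_function_norm_lt_1[OF a1 l1] by (auto simp: f_def)
  show "homogeneous_expansion (f a) (P a)" by (rule homogeneous_expansion_f[OF a])
  have "l 0 = 0" using scale[of 0 0] by (simp add: bounded_bilinear.zero_right[OF bounded_bilinear_scaleC])
  then show "cmod (f a 0) = a" using a by (simp add: f_def Moebius_function_of_zero)
qed (simp_all add: schwarz_map_\<mu> zero_of_order_\<mu>)

text \<open>On the ray through \<open>x0\<close> one has \<open>l (\<mu> n z) = - r ^ n\<close> for
  \<open>n \<ge> 1\<close>, so both series are geometric, with ratios \<open>a * \<rho>\<close> and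
  its square.\<close>

lemma bohr_functional_extremal:
  assumes k: "k \<ge> 1" and m: "m \<ge> 1" and a: "0 \<le> a" "a < 1" and r: "0 < r" "r < 1"
  shows "bohr_functional k m p lam a (f a) (P a) \<mu> (of_real r *\<^sub>C x0) = bohr_majorant k m p lam a r"
proof -
  define z where "z = of_real r *\<^sub>C x0"
  define \<rho> where "\<rho> = r ^ k"
  have \<rho>: "0 < \<rho>" "\<rho> < 1" using r k by (simp_all add: \<rho>_def power_less_one_iff)
  have lz: "l z = of_real r" and nz: "norm z = r" using r by (simp_all add: z_def scale l_x0 norm_scaleC norm_x0)
  have l\<mu>: "l (\<mu> n z) = - of_real (r ^ n)" if "n \<ge> 1" for n
  proof -
    have "\<mu> n z = (- of_real (r ^ (n - 1))) *\<^sub>C z"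
      by (simp add: \<mu>_def lz bounded_bilinear.minus_left[OF bounded_bilinear_scaleC])
    then have "l (\<mu> n z) = - of_real (r ^ (n - 1) * r)" by (simp add: scale lz)
    also have "r ^ (n - 1) * r = r ^ n" using that by (cases n) auto
    finally show ?thesis .
  qed
  have "f a (\<mu> m z) = of_real ((a + r ^ m) / (1 + a * r ^ m))"
    unfolding f_def l\<mu>[OF m] Moebius_function_simple minus_divide_left by simp
  then have 1: "cmod (f a (\<mu> m z)) = (a + r ^ m) / (1 + a * r ^ m)"
    using a r by (simp del: of_real_divide of_real_add)
  have a2: "1 - a\<^sup>2 \<ge> 0" using a by (simp add: power_le_one)
  have P: "cmod (P a (Suc j) (\<mu> k z)) = (1 - a\<^sup>2) * \<rho> * (a * \<rho>) ^ j" for j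
    unfolding P_def nat.case l\<mu>[OF k] norm_mult norm_power norm_minus_cancel norm_of_real
    using a a2 r by (simp add: abs_mult power_mult_distrib \<rho>_def)
  have "a * \<rho> \<le> \<rho>" using a \<rho> by (simp add: mult_left_le_one_le)
  then have a\<rho>: "a * \<rho> < 1" "a * \<rho> \<ge> 0"
    using \<rho>(2) by (rule le_less_trans) (use a \<rho> in simp)
  have s1: "(\<lambda>j. cmod (P a (Suc j) (\<mu> k z))) sums ((1 - a\<^sup>2) * \<rho> * (1 / (1 - a * \<rho>)))"
    unfolding P using a\<rho> by (intro sums_mult geometric_sums) auto
  have sq: "((1 - a\<^sup>2) * \<rho> * (a * \<rho>) ^ j)\<^sup>2 = ((1 - a\<^sup>2) * \<rho>)\<^sup>2 * ((a * \<rho>)\<^sup>2) ^ j" for j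
    by (simp add: power_mult_distrib mult.commute flip: power_mult)
  have a\<rho>2: "(a * \<rho>)\<^sup>2 < 1" using a\<rho> by (simp add: power_less_one_iff)
  then have s2: "(\<lambda>j. (cmod (P a (Suc j) (\<mu> k z)))\<^sup>2) sums (((1 - a\<^sup>2) * \<rho>)\<^sup>2 * (1 / (1 - (a * \<rho>)\<^sup>2)))"
    unfolding P sq by (intro sums_mult geometric_sums) auto
  have fac: "1 - a\<^sup>2 = (1 - a) * (1 + a)" "1 - (a * \<rho>)\<^sup>2 = (1 - a * \<rho>) * (1 + a * \<rho>)"
    by (simp_all add: algebra_simps power2_eq_square)
  have pos: "1 + a > 0" "1 - \<rho> > 0" "1 - a * \<rho> > 0" "1 + a * \<rho> > 0"
    using a(1) \<rho>(2) a\<rho> by linarith+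
  \<comment> \<open>The numerator cancels a factor of \<open>1 - (a * \<rho>)\<^sup>2\<close> in the
    sum of squares.\<close>
  have C: "1 / (1 + a) + \<rho> / (1 - \<rho>) = (1 + a * \<rho>) / ((1 + a) * (1 - \<rho>))"
    using pos by (simp add: field_simps)
  have "(1 + a * \<rho>) / ((1 + a) * (1 - \<rho>)) * (((1 - a) * (1 + a) * \<rho>)\<^sup>2 * (1 / ((1 - a * \<rho>) * (1 + a * \<rho>))))
      = (1 - a) * (1 + a) * \<rho> * ((1 - a) * \<rho>) / ((1 - \<rho>) * (1 - a * \<rho>))"
    using pos by (simp add: divide_simps) (simp add: power2_eq_square)
  moreover have "(1 - a) * (1 + a) * \<rho> * (1 / (1 - a * \<rho>))
      + (1 - a) * (1 + a) * \<rho> * ((1 - a) * \<rho>) / ((1 - \<rho>) * (1 - a * \<rho>)) = (1 - a) * (1 + a) * \<rho> / (1 - \<rho>)"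
  proof -
    have "(1 - a) * (1 + a) * \<rho> * (1 / (1 - a * \<rho>))
      + (1 - a) * (1 + a) * \<rho> * ((1 - a) * \<rho>) / ((1 - \<rho>) * (1 - a * \<rho>))
      = (1 - a) * (1 + a) * \<rho> * ((1 - \<rho>) + (1 - a) * \<rho>) / ((1 - \<rho>) * (1 - a * \<rho>))"
      using pos by (simp add: add_divide_distrib distrib_left)
    also have "(1 - \<rho>) + (1 - a) * \<rho> = 1 - a * \<rho>" by (simp add: algebra_simps)
    finally show ?thesis using pos by simp
  qed
  ultimately have "(\<Sum>j. cmod (P a (Suc j) (\<mu> k z)))
      + (1 / (1 + a) + \<rho> / (1 - \<rho>)) * (\<Sum>j. (cmod (P a (Suc j) (\<mu> k z)))\<^sup>2) = (1 - a\<^sup>2) * \<rho> / (1 - \<rho>)"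
    unfolding sums_unique[OF s1, symmetric] sums_unique[OF s2, symmetric] C fac by simp
  then show ?thesis
    unfolding z_def[symmetric] bohr_functional_def bohr_majorant_def 1 nz \<rho>_def by simp
qed

end

section \<open>Bohr radius\<close>

theorem theorem10:
  fixes k m :: nat and p lam a R\<^sub>4 :: real
  assumes X_nontrivial: "(UNIV :: 'a::complex_banach set) \<noteq> {0}"
    and k: "k \<ge> 1" and m: "m \<ge> 1"
    and p: "p > 0" and lam_pos: "lam > 0"
    and a: "0 \<le> a" "a < 1"
    and R4_root: "0 < R\<^sub>4" "R\<^sub>4 < 1" "\<Psi>\<^sub>4 k m p lam a R\<^sub>4 = 0"
    and R4_minimal: "\<And>r. 0 < r \<Longrightarrow> r < 1 \<Longrightarrow> \<Psi>\<^sub>4 k m p lam a r = 0 \<Longrightarrow> R\<^sub>4 \<le> r"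
  shows "(\<forall>(f :: 'a \<Rightarrow> complex) P \<mu> z.
            admissible_data a f P \<mu> \<and> norm z \<le> R\<^sub>4 \<longrightarrow>
            bohr_series_converge k P \<mu> z \<and> bohr_functional k m p lam a f P \<mu> z \<le> 1)
       \<and> (\<forall>R. R\<^sub>4 < R \<and> R < 1 \<longrightarrow>
            (\<exists>(f :: 'a \<Rightarrow> complex) P \<mu> z.
               admissible_data a f P \<mu> \<and> z \<in> ball 0 1 \<and> norm z \<le> R \<and>
               bohr_series_converge k P \<mu> z \<and> bohr_functional k m p lam a f P \<mu> z > 1))"
proof -
  let ?A = "bohr_majorant k m p lam a"
  note mono = bohr_majorant_strict_mono[OF k p lam_pos a, where m = m]
  have "R\<^sub>4 ^ k < 1" "1 + a * R\<^sub>4 ^ m > 0"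
    using R4_root k a by (auto simp: power_less_one_iff add_pos_nonneg)
  then have A: "?A R\<^sub>4 = 1"
    using \<Psi>\<^sub>4_eq_bohr_majorant[OF k a(1), of "R\<^sub>4" m p lam] R4_root by simp
  show ?thesis
  proof (intro conjI allI impI; (elim conjE)?)
    fix f :: "'a \<Rightarrow> complex" and P \<mu> and z :: 'a
    assume adm: "admissible_data a f P \<mu>" and z: "norm z \<le> R\<^sub>4"
    have z1: "norm z < 1" using z R4_root by simp
    note bound = bohr_functional_le_majorant[OF X_nontrivial k m p lam_pos a adm z1]
    show "bohr_series_converge k P \<mu> z" by (rule bound(1))
    have "?A (norm z) \<le> ?A R\<^sub>4"
      using mono[of "norm z" "R\<^sub>4"] z R4_root by (cases "norm z = R\<^sub>4") auto
    then show "bohr_functional k m p lam a f P \<mu> z \<le> 1" using bound(2) A by linarith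
  next
    fix R assume R: "R\<^sub>4 < R" "R < 1"
    obtain x0 :: 'a where x0: "norm x0 = 1" using unit_direction[OF X_nontrivial, of 0] by blast
    obtain l where l: "clinear l" "bounded_linear l" "\<And>z. cmod (l z) \<le> norm z" "l x0 = of_real (norm x0)"
      using complex_hahn_banach[of x0] by blast
    interpret norm_one_functional l x0
      by (rule norm_one_functional.intro) (use l x0 in auto)
    let ?z = "of_real R *\<^sub>C x0"
    have nz: "norm ?z = R" using R R4_root x0 by (simp add: norm_scaleC)
    have adm: "admissible_data a (f a) (P a) \<mu>" by (rule admissible_data[OF a])
    \<comment> \<open>The functional equals \<open>?A\<close> on the ray through \<open>x0\<close>,
      and \<open>?A\<close> has passed its value 1 at \<open>R\<^sub>4\<close>.\<close>
    have "?A R > 1" using mono[of "R\<^sub>4" R] R R4_root A by simp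
    then have "bohr_functional k m p lam a (f a) (P a) \<mu> ?z > 1"
      using bohr_functional_extremal[OF k m a, of R] R R4_root by simp
    moreover have "bohr_series_converge k (P a) \<mu> ?z"
      using bohr_functional_le_majorant(1)[OF X_nontrivial k m p lam_pos a adm, of ?z] nz R by simp
    moreover have "norm ?z \<le> R" "?z \<in> ball 0 1" using nz R by simp_all
    ultimately show "\<exists>(f :: 'a \<Rightarrow> complex) P \<mu> z.
               admissible_data a f P \<mu> \<and> z \<in> ball 0 1 \<and> norm z \<le> R \<and>
               bohr_series_converge k P \<mu> z \<and> bohr_functional k m p lam a f P \<mu> z > 1"
      using adm by blast
  qed
qed

end
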